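(* Let $\mathcal{H}$ be a complex Hilbert space, let $r$ and $s$ be positive rational numbers such that $r+s>1$, and let $\phi:\mathcal{S}(\mathcal{H})\to\mathcal{S}(\mathcal{H})$ be a surjective function (not assumed linear or continuous) which satisfies $$\sigma\big(|A|^r B|A|^s\big)=\sigma\big(|\phi(A)|^r\phi(B)|\phi(A)|^s\big)$$ for all $A\in\mathcal{P}_1(\mathcal{H})\cup\{I\}$ and all $B\in\mathcal{S}(\mathcal{H})$. Then there exists a bounded linear or conjugate linear bijection $T:\mathcal{H}\to\mathcal{H}$ satisfying $T^*=T^{-1}$ such that $$\phi(A)=TAT^*\quad\text{for all }A\in\mathcal{S}(\mathcal{H}).$$
   Context: $\mathcal{S}(\mathcal{H})$ is the set of all bounded self-adjoint operators on $\mathcal{H}$, $\mathcal{P}_1(\mathcal{H})$ is the set of all rank-one (orthogonal) projections on $\mathcal{H}$, $I$ is the identity operator, $\sigma(A)$ is the spectrum of the bounded operator $A$ on $\mathcal{H}$, and $|A|=(A^*A)^{1/2}$. For a positive rational number $r$, $|A|^r$ is defined by the continuous functional calculus. For a conjugate linear bounded $T$, the adjoint $T^*$ is the conjugate linear map determined by $\langle Tx,y\rangle=\langle T^*y,x\rangle$ for all $x,y$; thus the conclusion says that $T$ is unitary or antiunitary. *)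

theory Defs
  imports "HOL-Analysis.Analysis"
begin

text \<open>
  A complex Hilbert space is presented as a real Hilbert space together with a multiplication
  by complex scalars and a complex inner product whose real part is the real inner product.
  Hence the norm is the usual \<open>norm x = sqrt (Re (cinner x x))\<close>, see below. The complex inner
  product is linear in its first argument.
\<close>

class complex_inner = real_inner +
  fixes scaleC :: "complex \<Rightarrow> 'a \<Rightarrow> 'a"  (infixr \<open>*\<^sub>C\<close> 75)
    and cinner :: "'a \<Rightarrow> 'a \<Rightarrow> complex"
  assumes scaleC_add_right: "a *\<^sub>C (x + y) = a *\<^sub>C x + a *\<^sub>C y"
    and scaleC_add_left: "(a + b) *\<^sub>C x = a *\<^sub>C x + b *\<^sub>C x"
    and scaleC_scaleC: "a *\<^sub>C (b *\<^sub>C x) = (a * b) *\<^sub>C x"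
    and scaleC_of_real: "complex_of_real t *\<^sub>C x = t *\<^sub>R x"
    and cinner_commute: "cinner x y = cnj (cinner y x)"
    and cinner_add_left: "cinner (x + y) z = cinner x z + cinner y z"
    and cinner_scaleC_left: "cinner (a *\<^sub>C x) y = a * cinner x y"
    and inner_eq_Re_cinner: "inner x y = Re (cinner x y)"

class chilbert_space = complex_inner + complete_space

instantiation complex :: chilbert_space
begin

definition scaleC_complex :: "complex \<Rightarrow> complex \<Rightarrow> complex" where
  "scaleC_complex a x = a * x"

definition cinner_complex :: "complex \<Rightarrow> complex \<Rightarrow> complex" where
  "cinner_complex x y = x * cnj y"

instance
  by standard
    (auto simp: scaleC_complex_def cinner_complex_def algebra_simps inner_complex_def
      scaleR_conv_of_real)

end

lemma cinner_self:
  fixes x :: "'a::complex_inner"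
  shows "cinner x x = complex_of_real ((norm x)\<^sup>2)"
proof -
  have "Im (cinner x x) = - Im (cinner x x)"
    by (metis cinner_commute complex_cnj_cancel_iff cnj.sel(2))
  then show ?thesis
    by (simp add: complex_eq_iff power2_norm_eq_inner inner_eq_Re_cinner)
qed

lemma norm_eq_sqrt_cinner:
  fixes x :: "'a::complex_inner"
  shows "norm x = sqrt (Re (cinner x x))"
  by (simp add: norm_eq_sqrt_inner inner_eq_Re_cinner)

lemma norm_scaleC:
  fixes x :: "'a::complex_inner"
  shows "norm (a *\<^sub>C x) = cmod a * norm x"
proof -
  have "cinner (a *\<^sub>C x) (a *\<^sub>C x) = a * cnj a * cinner x x"
    by (metis (no_types, lifting) cinner_commute cinner_scaleC_left complex_cnj_mult mult.assoc mult.commute)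
  then have "complex_of_real ((norm (a *\<^sub>C x))\<^sup>2) = complex_of_real ((cmod a * norm x)\<^sup>2)"
    by (simp add: cinner_self power_mult_distrib flip: complex_norm_square)
  then have "(norm (a *\<^sub>C x))\<^sup>2 = (cmod a * norm x)\<^sup>2"
    using of_real_eq_iff by blast
  then show ?thesis
    by (simp add: power2_eq_iff_nonneg)
qed

text \<open>
  The type \<open>'a \<Rightarrow>\<^sub>L 'a\<close> of the library consists of all bounded real-linear maps, with the operator
  norm; the bounded complex-linear and the bounded conjugate linear maps are subsets of it.
\<close>

definition bounded_ops :: "('a::complex_inner \<Rightarrow>\<^sub>L 'a) set" where
  "bounded_ops = {A. \<forall>c x. blinfun_apply A (c *\<^sub>C x) = c *\<^sub>C blinfun_apply A x}"

definition conj_linear_ops :: "('a::complex_inner \<Rightarrow>\<^sub>L 'a) set" where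
  "conj_linear_ops = {T. \<forall>c x. blinfun_apply T (c *\<^sub>C x) = cnj c *\<^sub>C blinfun_apply T x}"

lift_definition scalar_op :: "complex \<Rightarrow> ('a::complex_inner \<Rightarrow>\<^sub>L 'a)"
  is "\<lambda>c x. c *\<^sub>C x"
proof (rule bounded_linear_intro)
  fix c :: complex and x y :: 'a and t :: real
  show "c *\<^sub>C (x + y) = c *\<^sub>C x + c *\<^sub>C y"
    by (rule scaleC_add_right)
  show "c *\<^sub>C (t *\<^sub>R x) = t *\<^sub>R (c *\<^sub>C x)"
    by (metis scaleC_of_real scaleC_scaleC mult.commute)
  show "norm (c *\<^sub>C x) \<le> norm x * cmod c"
    by (simp add: norm_scaleC)
qed

text \<open>
  Only \<open>T = 0\<close> is both linear and conjugate linear, and both clauses below then give \<open>0\<close>.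
\<close>

definition adj :: "('a::chilbert_space \<Rightarrow>\<^sub>L 'a) \<Rightarrow> ('a \<Rightarrow>\<^sub>L 'a)" where
  "adj T =
    (if T \<in> bounded_ops
     then (THE S. S \<in> bounded_ops \<and>
             (\<forall>x y. cinner (blinfun_apply T x) y = cinner x (blinfun_apply S y)))
     else (THE S. S \<in> conj_linear_ops \<and>
             (\<forall>x y. cinner (blinfun_apply T x) y = cinner (blinfun_apply S y) x)))"

definition self_adjoint_ops :: "('a::chilbert_space \<Rightarrow>\<^sub>L 'a) set" where
  "self_adjoint_ops = {A \<in> bounded_ops. adj A = A}"

definition rank_one_projections :: "('a::chilbert_space \<Rightarrow>\<^sub>L 'a) set" where
  "rank_one_projections =
    {P \<in> bounded_ops. P o\<^sub>L P = P \<and> adj P = P \<and>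
       (\<exists>x. x \<noteq> 0 \<and> range (blinfun_apply P) = range (\<lambda>c. c *\<^sub>C x))}"

definition spectrum :: "('a::chilbert_space \<Rightarrow>\<^sub>L 'a) \<Rightarrow> complex set" where
  "spectrum A =
    {l. \<not> (\<exists>S \<in> bounded_ops. S o\<^sub>L (A - scalar_op l) = id_blinfun \<and>
                              (A - scalar_op l) o\<^sub>L S = id_blinfun)}"

definition poly_op :: "real poly \<Rightarrow> ('a::chilbert_space \<Rightarrow>\<^sub>L 'a) \<Rightarrow> ('a \<Rightarrow>\<^sub>L 'a)" where
  "poly_op p A = (\<Sum>i\<le>degree p. coeff p i *\<^sub>R ((\<lambda>X. A o\<^sub>L X) ^^ i) id_blinfun)"

text \<open>
  Continuous functional calculus \<open>f(A)\<close> of a self-adjoint \<open>A\<close> (whose spectrum is real) and a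
  real function \<open>f\<close> that is continuous on the spectrum of \<open>A\<close>: the limit in operator norm of
  \<open>p\<^sub>n(A)\<close>, for any real polynomials \<open>p\<^sub>n\<close> converging to \<open>f\<close> uniformly on the spectrum.
\<close>

definition cfc :: "(real \<Rightarrow> real) \<Rightarrow> ('a::chilbert_space \<Rightarrow>\<^sub>L 'a) \<Rightarrow> ('a \<Rightarrow>\<^sub>L 'a)" where
  "cfc f A = (THE X. \<forall>p :: nat \<Rightarrow> real poly.
      uniform_limit {t. complex_of_real t \<in> spectrum A} (\<lambda>n. poly (p n)) f sequentially
        \<longrightarrow> (\<lambda>n. poly_op (p n) A) \<longlonglongrightarrow> X)"

definition abs_op :: "('a::chilbert_space \<Rightarrow>\<^sub>L 'a) \<Rightarrow> ('a \<Rightarrow>\<^sub>L 'a)" where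
  "abs_op A = cfc sqrt (adj A o\<^sub>L A)"

text \<open>
  \<open>\<bar>A\<bar>\<^sup>r\<close> for \<open>r > 0\<close>; as \<open>0 powr r = 0\<close>, the function used is continuous on the nonnegative reals.
\<close>

definition abs_power :: "('a::chilbert_space \<Rightarrow>\<^sub>L 'a) \<Rightarrow> rat \<Rightarrow> ('a \<Rightarrow>\<^sub>L 'a)" where
  "abs_power A r = cfc (\<lambda>t. t powr of_rat r) (abs_op A)"

end

(*
  Taking A = B = I shows that \<phi> fixes I, so \<phi> preserves spectra. For a unit vector u and P = rank1 u, the
  sandwich is <Bu, u> P, whose spectrum determines <Bu, u>; hence \<phi> sends rank-one projections to
  rank-one projections (onto them all) and preserves expectation values. The latter makes \<phi> real linear.
  Fix a unit vector e, with \<phi> (rank1 e) = rank1 f. For x orthogonal to e, \<phi> sends the operator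
  <., e> x + <., x> e to <., f> y + <., y> f for a unique y = S x orthogonal to f, and rank1 x to rank1 (S x).
  So S is a real-linear isometry with S (i x) = i S x or S (i x) = - i S x, and by additivity the sign does
  not depend on x. Extending S by e |-> f yields the unitary or antiunitary T.
*)
theory Submission
  imports Defs "HOL-Computational_Algebra.Fundamental_Theorem_Algebra"
begin

section \<open>Complex inner products and adjoints\<close>

text \<open>Spectra enter only through approximate eigenvectors: for a self-adjoint operator they
  detect every real spectral point, and unit vectors that are approximate eigenvectors of
  \<open>A\<close> for \<open>l\<close> remain so for \<open>f(A)\<close> and \<open>f l\<close>.
  This replaces the spectral mapping theorem in the proof that the identity is fixed. The functional
  calculus rests on one estimate: the norm of \<open>p(A)\<close> is bounded by any bound of |p| on
  the real points of the spectrum. The obstacle in the second half is phase: a rank-one projection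
  fixes its unit vector only up to a factor of modulus one, so vectors picked ray by ray need not
  add up. Pairing \<open>x\<close> with the fixed \<open>e\<close> in a single self-adjoint operator
  settles the phase relative to \<open>f\<close>, and since that operator is additive in
  \<open>x\<close>, so is \<open>S\<close>.\<close>

instance chilbert_space \<subseteq> banach ..

lemma scaleC_zero_left [simp]: "0 *\<^sub>C x = (0::'a::complex_inner)"
  using scaleC_of_real[of 0 x] by simp

lemma scaleC_one [simp]: "1 *\<^sub>C x = (x::'a::complex_inner)"
  using scaleC_of_real[of 1 x] by simp

lemma scaleC_zero_right [simp]: "c *\<^sub>C 0 = (0::'a::complex_inner)"
  using scaleC_add_right[of c "0::'a" 0] by simp

lemma scaleC_minus_right [simp]: "c *\<^sub>C (- x) = - (c *\<^sub>C (x::'a::complex_inner))"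
  using scaleC_add_right[of c x "- x"] by (simp add: eq_neg_iff_add_eq_0 add.commute)

lemma scaleC_minus_left [simp]: "(- c) *\<^sub>C x = - (c *\<^sub>C (x::'a::complex_inner))"
  using scaleC_add_left[of c "- c" x] by (simp add: eq_neg_iff_add_eq_0 add.commute)

lemma scaleC_diff_right: "c *\<^sub>C (x - y) = c *\<^sub>C x - c *\<^sub>C (y::'a::complex_inner)"
  using scaleC_add_right[of c x "- y"] by simp

lemma scaleC_diff_left: "(c - d) *\<^sub>C x = c *\<^sub>C x - d *\<^sub>C (x::'a::complex_inner)"
  using scaleC_add_left[of c "- d" x] by simp

lemma scaleR_scaleC_commute: "c *\<^sub>C (t *\<^sub>R x) = t *\<^sub>R (c *\<^sub>C (x::'a::complex_inner))"
  by (metis scaleC_of_real scaleC_scaleC mult.commute)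

lemma scaleC_eq_Re_Im: "c *\<^sub>C x = Re c *\<^sub>R x + Im c *\<^sub>R (\<i> *\<^sub>C (x::'a::complex_inner))"
proof -
  have "c *\<^sub>C x = (complex_of_real (Re c) + complex_of_real (Im c) * \<i>) *\<^sub>C x"
    by (simp add: mult.commute flip: complex_eq)
  then show ?thesis
    by (simp only: scaleC_add_left scaleC_scaleC[symmetric] scaleC_of_real)
qed

lemma cinner_add_right: "cinner x (y + z) = cinner x y + cinner x (z::'a::complex_inner)"
  by (metis cinner_add_left cinner_commute complex_cnj_add)

lemma cinner_scaleC_right: "cinner x (c *\<^sub>C y) = cnj c * cinner x (y::'a::complex_inner)"
  by (metis cinner_commute cinner_scaleC_left complex_cnj_mult)

lemma cinner_zero_left [simp]: "cinner 0 (y::'a::complex_inner) = 0"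
  using cinner_add_left[of "0::'a" 0 y] by simp

lemma cinner_zero_right [simp]: "cinner y (0::'a::complex_inner) = 0"
  using cinner_add_right[of y "0::'a" 0] by simp

lemma cinner_minus_left [simp]: "cinner (- x) (y::'a::complex_inner) = - cinner x y"
  using cinner_add_left[of x "- x" y] by (simp add: eq_neg_iff_add_eq_0 add.commute)

lemma cinner_minus_right [simp]: "cinner x (- (y::'a::complex_inner)) = - cinner x y"
  using cinner_add_right[of x y "- y"] by (simp add: eq_neg_iff_add_eq_0 add.commute)

lemma cinner_diff_left: "cinner (x - y) z = cinner x z - cinner y (z::'a::complex_inner)"
  using cinner_add_left[of x "- y" z] by simp

lemma cinner_diff_right: "cinner x (y - z) = cinner x y - cinner x (z::'a::complex_inner)"
  using cinner_add_right[of x y "- z"] by simp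

lemma cinner_scaleR_left: "cinner (t *\<^sub>R x) (y::'a::complex_inner) = of_real t * cinner x y"
  by (metis cinner_scaleC_left scaleC_of_real)

lemma cinner_scaleR_right: "cinner x (t *\<^sub>R (y::'a::complex_inner)) = of_real t * cinner x y"
  by (metis cinner_scaleC_right scaleC_of_real complex_cnj_complex_of_real)

lemmas cinner_simps = cinner_add_left cinner_add_right cinner_scaleC_left cinner_scaleC_right
  cinner_diff_left cinner_diff_right cinner_scaleR_left cinner_scaleR_right

lemma cinner_eq_0_commute: "cinner x y = 0 \<longleftrightarrow> cinner y (x::'a::complex_inner) = 0"
  by (metis cinner_commute complex_cnj_zero)

lemma norm_add_orthogonal:
  fixes x y :: "'a::complex_inner"
  assumes "cinner x y = 0"
  shows "(norm (x + y))\<^sup>2 = (norm x)\<^sup>2 + (norm y)\<^sup>2"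
proof -
  have "inner x y = 0" using assms by (simp add: inner_eq_Re_cinner)
  then show ?thesis by (simp add: power2_norm_eq_inner inner_simps inner_commute)
qed

section \<open>Riesz representation and adjoints\<close>

lemma riesz_representation:
  fixes f :: "'a::{real_inner,complete_space} \<Rightarrow> real"
  assumes "bounded_linear f"
  obtains y where "\<And>x. f x = inner x y"
proof -
  interpret f: bounded_linear f by fact
  obtain K where K: "\<And>x. norm (f x) \<le> norm x * K" using f.bounded by blast
  \<comment> \<open>The representing vector is the minimizer of \<open>J\<close>: the parallelogram
    law makes minimizing sequences Cauchy, and the first variation at the minimizer vanishes, which
    is the Riesz identity.\<close>
  define J where "J x = (norm x)\<^sup>2 - 2 * f x" for x
  have lower: "- K\<^sup>2 \<le> J x" for x
  proof -
    have "0 \<le> (norm x - K)\<^sup>2" by simp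
    then show ?thesis using K[of x] by (simp add: J_def power2_diff abs_le_iff)
  qed
  have bdd: "bdd_below (range J)" using lower by (intro bdd_belowI[of _ "- K\<^sup>2"]) auto
  define m where "m = Inf (range J)"
  have m_le: "m \<le> J x" for x unfolding m_def by (rule cInf_lower[OF _ bdd]) auto
  have "\<exists>x. J x < m + inverse (real (Suc n))" for n
    using cInf_lessD[of "range J" "m + inverse (real (Suc n))"] by (auto simp: m_def)
  then obtain x where x: "\<And>n. J (x n) < m + inverse (real (Suc n))" by metis
  have par: "(norm (u - v))\<^sup>2 = 2 * J u + 2 * J v - 4 * J ((1/2) *\<^sub>R (u + v))" for u v
  proof -
    have "(norm (u - v))\<^sup>2 + (norm (u + v))\<^sup>2 = 2 * (norm u)\<^sup>2 + 2 * (norm v)\<^sup>2"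
      by (simp add: power2_norm_eq_inner inner_simps inner_commute)
    moreover have "J ((1/2) *\<^sub>R (u + v)) = (norm (u + v))\<^sup>2 / 4 - (f u + f v)"
      by (simp add: J_def f.scaleR f.add power_mult_distrib power_divide) argo
    ultimately show ?thesis by (simp add: J_def)
  qed
  have "Cauchy x"
  proof (rule metric_CauchyI)
    fix e :: real assume "0 < e"
    then obtain N where N: "inverse (real (Suc N)) < e\<^sup>2 / 4"
      using reals_Archimedean[of "e\<^sup>2/4"] by auto
    have "dist (x i) (x j) < e" if "N \<le> i" "N \<le> j" for i j
    proof -
      have "inverse (real (Suc i)) \<le> inverse (real (Suc N))" "inverse (real (Suc j)) \<le> inverse (real (Suc N))"
        using that by (auto intro!: le_imp_inverse_le)
      then have "(norm (x i - x j))\<^sup>2 < e\<^sup>2"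
        using par[of "x i" "x j"] x[of i] x[of j] m_le[of "(1/2) *\<^sub>R (x i + x j)"] N by linarith
      then show ?thesis using \<open>0 < e\<close> by (simp add: dist_norm power2_less_imp_less)
    qed
    then show "\<exists>M. \<forall>i\<ge>M. \<forall>j\<ge>M. dist (x i) (x j) < e" by blast
  qed
  then obtain y where y: "x \<longlonglongrightarrow> y" using Cauchy_convergent convergent_def by blast
  have "(\<lambda>n. J (x n)) \<longlonglongrightarrow> J y"
    unfolding J_def by (intro tendsto_intros y f.tendsto)
  moreover have "(\<lambda>n. J (x n)) \<longlonglongrightarrow> m"
  proof (rule tendsto_sandwich[OF _ _ tendsto_const])
    show "(\<lambda>n. m + inverse (real (Suc n))) \<longlonglongrightarrow> m"
      using tendsto_add[OF tendsto_const LIMSEQ_inverse_real_of_nat, of m] by simp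
  qed (use m_le less_imp_le[OF x] in auto)
  ultimately have Jy: "J y = m" by (rule LIMSEQ_unique)
  have "f z = inner z y" for z
  proof (cases "z = 0")
    case False
    define d where "d = inner z y - f z"
    \<comment> \<open>The minimum over \<open>t\<close> of
      \<open>J y + 2 * t * d + t^2 * (norm z)^2\<close>; minimality of \<open>y\<close> then forces
      \<open>d = 0\<close>.\<close>
    define t where "t = - d / (norm z)\<^sup>2"
    have nz: "(norm z)\<^sup>2 > 0" using False by simp
    have "J y \<le> J (y + t *\<^sub>R z)" using Jy m_le by simp
    also have "J (y + t *\<^sub>R z) = J y + 2 * t * d + t\<^sup>2 * (norm z)\<^sup>2"
    proof -
      have "(norm (y + t *\<^sub>R z))\<^sup>2 = (norm y)\<^sup>2 + 2 * t * inner z y + t * t * (norm z)\<^sup>2"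
        by (simp add: power2_norm_eq_inner inner_simps inner_commute algebra_simps)
      then show ?thesis
        by (simp add: J_def d_def f.scaleR f.add power2_eq_square[of t] algebra_simps)
    qed
    also have "\<dots> = J y - d\<^sup>2 / (norm z)\<^sup>2"
      using nz by (simp add: t_def power2_eq_square field_simps)
    finally have "d\<^sup>2 / (norm z)\<^sup>2 \<le> 0" by simp
    then have "d\<^sup>2 \<le> 0" using nz by (simp add: divide_le_0_iff)
    then show ?thesis by (simp add: d_def)
  qed (simp add: f.zero)
  then show thesis by (rule that)
qed

text \<open>Riesz applied to \<open>inner (T x) y\<close> as a functional of \<open>x\<close>. The
  argument is purely real, so it serves linear and conjugate linear \<open>T\<close> alike.\<close>

lemma real_adjoint_exists:
  fixes T :: "'a::{real_inner,complete_space} \<Rightarrow>\<^sub>L 'a"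
  obtains S :: "'a \<Rightarrow>\<^sub>L 'a" where "\<And>x y. inner (T x) y = inner x (S y)"
proof -
  have "\<exists>z. \<forall>x. inner (T x) y = inner x z" for y
  proof -
    have "bounded_linear (\<lambda>x. inner (T x) y)"
      by (intro bounded_linear_intros)
    then show ?thesis using riesz_representation by metis
  qed
  then obtain g where g: "\<And>x y. inner (T x) y = inner x (g y)" by metis
  have "bounded_linear g"
  proof (rule bounded_linear_intro)
    fix x y :: 'a and t :: real
    show "g (x + y) = g x + g y"
      by (rule vector_eq_rdot[THEN iffD1]) (metis g inner_add_right inner_commute)
    show "g (t *\<^sub>R x) = t *\<^sub>R g x"
      by (rule vector_eq_rdot[THEN iffD1]) (metis g inner_scaleR_right inner_commute)
    have "(norm (g x))\<^sup>2 = inner (T (g x)) x"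
      by (simp add: g power2_norm_eq_inner)
    also have "\<dots> \<le> norm (T (g x)) * norm x" by (rule norm_cauchy_schwarz)
    also have "\<dots> \<le> norm T * norm (g x) * norm x" by (intro mult_right_mono norm_blinfun) auto
    finally have "norm (g x) * norm (g x) \<le> norm (g x) * (norm x * norm T)"
      by (simp add: power2_eq_square mult_ac)
    then show "norm (g x) \<le> norm x * norm T"
      by (cases "norm (g x) = 0") (auto simp: mult_le_cancel_left)
  qed
  then show thesis using g that[of "Blinfun g"] by (simp add: bounded_linear_Blinfun_apply)
qed

lemma bounded_opsD: "A \<in> bounded_ops \<Longrightarrow> A (c *\<^sub>C x) = c *\<^sub>C A x"
  by (simp add: bounded_ops_def)

text \<open>An imaginary part is minus the real part after multiplication by i, and linearity moves
  i through \<open>T\<close>; so an adjoint for the real inner product is one for the complex inner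
  product.\<close>

lemma cinner_adjoint_linear:
  assumes T: "T \<in> bounded_ops" and S: "\<And>x y. inner (T x) y = inner x (S y)"
  shows "cinner (T x) y = cinner x (S y)"
proof -
  have "Im (cinner (T x) y) = - inner (\<i> *\<^sub>C T x) y"
    by (simp add: inner_eq_Re_cinner cinner_scaleC_left)
  also have "\<dots> = - inner (\<i> *\<^sub>C x) (S y)"
    by (simp add: S flip: bounded_opsD[OF T])
  also have "\<dots> = Im (cinner x (S y))"
    by (simp add: inner_eq_Re_cinner cinner_scaleC_left)
  finally show ?thesis using S[of x y] by (simp add: complex_eq_iff inner_eq_Re_cinner)
qed

lemma cinner_adjoint_conj_linear:
  assumes T: "T \<in> conj_linear_ops" and S: "\<And>x y. inner (T x) y = inner x (S y)"
  shows "cinner (T x) y = cinner (S y) x"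
proof -
  have "Im (cinner (T x) y) = inner (T (\<i> *\<^sub>C x)) y"
    using T by (simp add: conj_linear_ops_def inner_eq_Re_cinner cinner_scaleC_left)
  also have "\<dots> = inner (S y) (\<i> *\<^sub>C x)"
    by (metis S inner_commute)
  also have "\<dots> = Im (cinner (S y) x)"
    by (simp add: inner_eq_Re_cinner cinner_scaleC_right)
  finally show ?thesis using S[of x y]
    by (simp add: complex_eq_iff inner_eq_Re_cinner[symmetric] inner_commute)
qed

lemma cinner_eqI_right:
  assumes "\<And>z. cinner z x = cinner z (y::'a::complex_inner)"
  shows "x = y"
  by (rule vector_eq_ldot[THEN iffD1]) (use assms in \<open>simp add: inner_eq_Re_cinner\<close>)

text \<open>Discharges the definite descriptions in \<open>adj\<close>: the real adjoint is the
  unique witness in either clause. With the real inner product both cases take the same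
  form.\<close>

lemma adj_inner:
  assumes T: "T \<in> bounded_ops \<or> T \<in> conj_linear_ops"
  shows "inner (T x) y = inner x (adj T y)"
proof -
  obtain S where S: "\<And>x y. inner (T x) y = inner x (blinfun_apply S y)"
    using real_adjoint_exists by blast
  have "adj T = S"
  proof (cases "T \<in> bounded_ops")
    case True
    note c = cinner_adjoint_linear[OF True S]
    have "S \<in> bounded_ops"
      unfolding bounded_ops_def
    proof (intro CollectI allI)
      fix k y show "S (k *\<^sub>C y) = k *\<^sub>C S y"
        by (rule cinner_eqI_right) (metis c cinner_scaleC_right)
    qed
    moreover have "S' = S" if "\<And>x y. cinner (T x) y = cinner x (blinfun_apply S' y)" for S'
      by (rule blinfun_eqI, rule cinner_eqI_right) (metis c that)
    ultimately have "(THE S'. S' \<in> bounded_ops \<and> (\<forall>x y. cinner (T x) y = cinner x (blinfun_apply S' y))) = S"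
      using c by (intro the_equality) blast+
    then show ?thesis using True by (simp add: adj_def)
  next
    case False
    with T have T': "T \<in> conj_linear_ops" by simp
    note c = cinner_adjoint_conj_linear[OF T' S]
    have eq: "x = y" if "\<And>z. cinner x z = cinner (y::'a) z" for x y
      by (rule cinner_eqI_right) (metis that cinner_commute)
    have "S \<in> conj_linear_ops"
      unfolding conj_linear_ops_def
    proof (intro CollectI allI)
      fix k y show "S (k *\<^sub>C y) = cnj k *\<^sub>C S y"
        by (rule eq) (metis c cinner_scaleC_right cinner_scaleC_left)
    qed
    moreover have "S' = S" if "\<And>x y. cinner (T x) y = cinner (blinfun_apply S' y) x" for S'
      by (rule blinfun_eqI, rule eq) (metis c that)
    ultimately have "(THE S'. S' \<in> conj_linear_ops \<and> (\<forall>x y. cinner (T x) y = cinner (blinfun_apply S' y) x)) = S"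
      using c by (intro the_equality) blast+
    then show ?thesis using False by (simp add: adj_def)
  qed
  then show ?thesis using S by simp
qed

lemma self_adjoint_ops_iff:
  "A \<in> self_adjoint_ops \<longleftrightarrow> A \<in> bounded_ops \<and> (\<forall>x y. inner (A x) y = inner x (A y))"
proof
  assume "A \<in> self_adjoint_ops"
  then show "A \<in> bounded_ops \<and> (\<forall>x y. inner (A x) y = inner x (A y))"
    using adj_inner[of A] by (simp add: self_adjoint_ops_def)
next
  assume A: "A \<in> bounded_ops \<and> (\<forall>x y. inner (A x) y = inner x (A y))"
  then have "inner x (adj A y) = inner x (A y)" for x y
    using adj_inner[of A x y] by simp
  then have "adj A = A"
    by (intro blinfun_eqI) (metis vector_eq_ldot)
  with A show "A \<in> self_adjoint_ops" by (simp add: self_adjoint_ops_def)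
qed

lemma sa_inner: "A \<in> self_adjoint_ops \<Longrightarrow> inner (A x) y = inner x (A y)"
  by (simp add: self_adjoint_ops_iff)

lemma sa_bounded: "A \<in> self_adjoint_ops \<Longrightarrow> A \<in> bounded_ops"
  by (simp add: self_adjoint_ops_iff)

lemma sa_cinner: "A \<in> self_adjoint_ops \<Longrightarrow> cinner (A x) y = cinner x (A y)"
  by (rule cinner_adjoint_linear) (auto simp: self_adjoint_ops_iff)

text \<open>Polarization; for symmetric operators the real form at \<open>x + y\<close> is
  enough.\<close>

lemma sa_eqI:
  assumes "A \<in> self_adjoint_ops" "B \<in> self_adjoint_ops"
    and eq: "\<And>x. norm x = 1 \<Longrightarrow> inner (A x) x = inner (B x) x"
  shows "A = B"
proof -
  have q: "inner (A x) x = inner (B x) x" for x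
  proof (cases "x = 0")
    case False
    then have "inner (A (x /\<^sub>R norm x)) (x /\<^sub>R norm x) = inner (B (x /\<^sub>R norm x)) (x /\<^sub>R norm x)"
      by (intro eq) simp
    with False show ?thesis by (simp add: blinfun.bilinear_simps)
  qed simp
  have "inner (A x) y = inner (B x) y" for x y
    using q[of "x + y"] q[of x] q[of y] sa_inner[OF assms(1), of x y] sa_inner[OF assms(2), of x y]
    by (simp add: blinfun.bilinear_simps inner_simps inner_commute)
  then show ?thesis by (intro blinfun_eqI) (metis vector_eq_rdot)
qed

lemma bounded_ops_closed [simp, intro]:
  "id_blinfun \<in> bounded_ops" "0 \<in> bounded_ops" "scalar_op c \<in> bounded_ops"
  "A \<in> bounded_ops \<Longrightarrow> B \<in> bounded_ops \<Longrightarrow> A + B \<in> bounded_ops"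
  "A \<in> bounded_ops \<Longrightarrow> B \<in> bounded_ops \<Longrightarrow> A - B \<in> bounded_ops"
  "A \<in> bounded_ops \<Longrightarrow> B \<in> bounded_ops \<Longrightarrow> A o\<^sub>L B \<in> bounded_ops"
  "A \<in> bounded_ops \<Longrightarrow> t *\<^sub>R A \<in> bounded_ops"
  by (auto simp: bounded_ops_def blinfun.bilinear_simps scaleC_add_right scaleC_diff_right
      scaleR_scaleC_commute scalar_op.rep_eq scaleC_scaleC mult.commute)

lemma sa_closed [simp, intro]:
  "id_blinfun \<in> self_adjoint_ops" "0 \<in> self_adjoint_ops"
  "A \<in> self_adjoint_ops \<Longrightarrow> B \<in> self_adjoint_ops \<Longrightarrow> A + B \<in> self_adjoint_ops"
  "A \<in> self_adjoint_ops \<Longrightarrow> B \<in> self_adjoint_ops \<Longrightarrow> A - B \<in> self_adjoint_ops"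
  "A \<in> self_adjoint_ops \<Longrightarrow> t *\<^sub>R A \<in> self_adjoint_ops"
  by (auto simp: self_adjoint_ops_iff blinfun.bilinear_simps inner_simps)

lemma sa_compose:
  assumes "A \<in> self_adjoint_ops" "B \<in> self_adjoint_ops" "A o\<^sub>L B = B o\<^sub>L A"
  shows "A o\<^sub>L B \<in> self_adjoint_ops"
  using assms by (auto simp: self_adjoint_ops_iff) (metis blinfun_apply_blinfun_compose)

lemma sa_limit:
  assumes "X \<longlonglongrightarrow> A" "\<And>n. X n \<in> self_adjoint_ops"
  shows "A \<in> self_adjoint_ops"
proof -
  have l: "(\<lambda>n. X n x) \<longlonglongrightarrow> A x" for x
    by (intro blinfun.tendsto assms tendsto_const)
  have cont: "(\<lambda>n. c *\<^sub>C X n x) \<longlonglongrightarrow> c *\<^sub>C A x" for c x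
    using blinfun.tendsto[OF tendsto_const l, of "scalar_op c"] by (simp add: scalar_op.rep_eq)
  have "A (c *\<^sub>C x) = c *\<^sub>C A x" for c x
    using l[of "c *\<^sub>C x"] cont[of c x] assms(2) by (intro LIMSEQ_unique) (auto simp: sa_bounded bounded_opsD)
  moreover have "inner (A x) y = inner x (A y)" for x y
    using tendsto_inner[OF l tendsto_const, of x y] tendsto_inner[OF tendsto_const l, of x y]
    by (intro LIMSEQ_unique) (auto simp: sa_inner[OF assms(2)])
  ultimately show ?thesis by (simp add: self_adjoint_ops_iff bounded_ops_def)
qed

section \<open>Spectra of self-adjoint operators\<close>

definition invertible_op :: "('a::chilbert_space \<Rightarrow>\<^sub>L 'a) \<Rightarrow> bool" where
  "invertible_op A \<longleftrightarrow> (\<exists>S \<in> bounded_ops. S o\<^sub>L A = id_blinfun \<and> A o\<^sub>L S = id_blinfun)"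

lemma spectrum_iff: "l \<in> spectrum A \<longleftrightarrow> \<not> invertible_op (A - scalar_op l)"
  by (simp add: spectrum_def invertible_op_def)

lemma scalar_op_of_real: "scalar_op (of_real t) = t *\<^sub>R id_blinfun"
  by (rule blinfun_eqI) (simp add: scalar_op.rep_eq scaleC_of_real blinfun.scaleR_left)

text \<open>Lax-Milgram by Banach's fixed point theorem: solutions of \<open>G x = y\<close> are the
  fixed points of \<open>F\<close>, which steps against the residual and contracts for a suitable
  step \<open>t\<close>.\<close>

lemma coercive_surj:
  fixes G :: "'a::{real_inner,complete_space} \<Rightarrow>\<^sub>L 'a"
  assumes c: "c > 0" "\<And>x. c * (norm x)\<^sup>2 \<le> inner (G x) x"
  shows "\<exists>x. G x = y"
proof -
  define M where "M = norm G + c"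
  have M: "0 < M" "c \<le> M" "norm G \<le> M" using c(1) by (auto simp: M_def add_nonneg_pos)
  \<comment> \<open>Minimizes \<open>1 - 2 * t * c + t^2 * M^2\<close>, which bounds the squared
    contraction factor; \<open>k\<close> is the minimum, nonnegative because
    \<open>c \<le> M\<close>.\<close>
  define t where "t = c / M\<^sup>2"
  define k where "k = 1 - c\<^sup>2 / M\<^sup>2"
  have t0: "0 < t" using M c by (simp add: t_def)
  have "c\<^sup>2 \<le> M\<^sup>2" using M c by (simp add: power_mono)
  then have k: "0 \<le> k" "k < 1" using M c by (auto simp: k_def divide_le_eq_1)
  define F where "F x = x - t *\<^sub>R (G x - y)" for x
  have "dist (F u) (F v) \<le> sqrt k * dist u v" for u v
  proof -
    define d where "d = u - v"
    have F: "F u - F v = d - t *\<^sub>R G d" by (simp add: F_def d_def blinfun.diff_right algebra_simps)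
    have "norm (G d) \<le> M * norm d"
      using norm_blinfun[of G d] M(3) by (meson mult_right_mono norm_ge_zero order_trans)
    then have G2: "(norm (G d))\<^sup>2 \<le> M\<^sup>2 * (norm d)\<^sup>2"
      by (metis power_mono norm_ge_zero power_mult_distrib)
    have "(norm (d - t *\<^sub>R G d))\<^sup>2 = (norm d)\<^sup>2 - 2 * t * inner (G d) d + t\<^sup>2 * (norm (G d))\<^sup>2"
      unfolding power2_norm_eq_inner
      by (simp add: inner_simps inner_commute) (simp add: power2_eq_square)
    also have "\<dots> \<le> (norm d)\<^sup>2 - 2 * t * (c * (norm d)\<^sup>2) + t\<^sup>2 * (M\<^sup>2 * (norm d)\<^sup>2)"
      using t0 c(2)[of d] G2 by (intro add_mono diff_mono mult_left_mono) auto
    also have "\<dots> = k * (norm d)\<^sup>2"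
      using M by (simp add: k_def t_def power2_eq_square field_simps)
    finally have "norm (d - t *\<^sub>R G d) \<le> sqrt (k * (norm d)\<^sup>2)" by (rule real_le_rsqrt)
    then show ?thesis by (simp add: dist_norm F real_sqrt_mult) (simp add: d_def)
  qed
  then have "\<exists>!x. F x = x"
    using k by (intro banach_fix_type[of "sqrt k"]) auto
  then obtain x where "F x = x" by blast
  then show ?thesis using t0 by (auto simp: F_def)
qed

lemma coercive_invertible:
  assumes G: "G \<in> bounded_ops" and c: "c > 0" "\<And>x. c * (norm x)\<^sup>2 \<le> inner (G x) x"
  shows "invertible_op (G :: 'a::chilbert_space \<Rightarrow>\<^sub>L 'a)"
proof -
  obtain g where g: "\<And>y. G (g y) = y" using coercive_surj[OF c] by metis
  have inj: "x = y" if "G x = G y" for x y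
  proof -
    have "c * (norm (x - y))\<^sup>2 \<le> 0" using c(2)[of "x - y"] that by (simp add: blinfun.diff_right)
    then show ?thesis using c(1) by (simp add: mult_le_0_iff)
  qed
  have "bounded_linear g"
  proof (rule bounded_linear_intro)
    fix x y :: 'a and t :: real
    show "g (x + y) = g x + g y" by (rule inj) (simp add: g blinfun.add_right)
    show "g (t *\<^sub>R x) = t *\<^sub>R g x" by (rule inj) (simp add: g blinfun.scaleR_right)
    have "c * (norm (g x))\<^sup>2 \<le> norm x * norm (g x)"
      using c(2)[of "g x"] norm_cauchy_schwarz[of x "g x"] by (simp add: g)
    then have "c * norm (g x) \<le> norm x"
      by (cases "norm (g x) = 0") (auto simp: power2_eq_square mult.assoc[symmetric] mult_le_cancel_right)
    then show "norm (g x) \<le> norm x * (1 / c)" using c(1) by (simp add: field_simps)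
  qed
  then have a: "blinfun_apply (Blinfun g) = g" by (rule bounded_linear_Blinfun_apply)
  have "g (k *\<^sub>C x) = k *\<^sub>C g x" for k x by (rule inj) (simp add: g bounded_opsD[OF G])
  then have "Blinfun g \<in> bounded_ops" by (simp add: bounded_ops_def a)
  moreover have "Blinfun g o\<^sub>L G = id_blinfun" "G o\<^sub>L Blinfun g = id_blinfun"
    by (auto intro!: blinfun_eqI simp: a g intro: inj)
  ultimately show ?thesis by (auto simp: invertible_op_def)
qed

lemma blinfun_compose_assoc: "(A o\<^sub>L B) o\<^sub>L C = A o\<^sub>L (B o\<^sub>L C)"
  by (rule blinfun_eqI) simp

lemma blinfun_compose_id [simp]: "A o\<^sub>L id_blinfun = A" "id_blinfun o\<^sub>L A = A"
  by (auto intro: blinfun_eqI)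

text \<open>\<open>S o\<^sub>L B\<close> is a left inverse of \<open>A\<close> by commutation and
  \<open>B o\<^sub>L S\<close> a right inverse, so the two agree.\<close>

lemma invertible_op_factor:
  assumes "A \<in> bounded_ops" "B \<in> bounded_ops" "A o\<^sub>L B = B o\<^sub>L A" "invertible_op (A o\<^sub>L B)"
  shows "invertible_op A"
proof -
  obtain S where S: "S \<in> bounded_ops" "S o\<^sub>L (A o\<^sub>L B) = id_blinfun" "(A o\<^sub>L B) o\<^sub>L S = id_blinfun"
    using assms(4) by (auto simp: invertible_op_def)
  have l: "(S o\<^sub>L B) o\<^sub>L A = id_blinfun" using S assms(3) by (metis blinfun_compose_assoc)
  have r: "A o\<^sub>L (B o\<^sub>L S) = id_blinfun" using S by (metis blinfun_compose_assoc)
  have "S o\<^sub>L B = B o\<^sub>L S" by (metis l r blinfun_compose_assoc blinfun_compose_id)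
  then show ?thesis using l r S assms unfolding invertible_op_def by (metis bounded_ops_closed(6))
qed

lemma invertible_op_comp:
  assumes "invertible_op A" "invertible_op B"
  shows "invertible_op (A o\<^sub>L B)"
proof -
  obtain S T where S: "S \<in> bounded_ops" "S o\<^sub>L A = id_blinfun" "A o\<^sub>L S = id_blinfun"
    and T: "T \<in> bounded_ops" "T o\<^sub>L B = id_blinfun" "B o\<^sub>L T = id_blinfun"
    using assms by (auto simp: invertible_op_def)
  have "(T o\<^sub>L S) o\<^sub>L (A o\<^sub>L B) = id_blinfun" "(A o\<^sub>L B) o\<^sub>L (T o\<^sub>L S) = id_blinfun"
    using S T by (metis blinfun_compose_assoc blinfun_compose_id)+
  then show ?thesis using S T unfolding invertible_op_def by blast
qed

section \<open>Approximate eigenvectors and the norm as a spectral value\<close>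

lemma invertible_op_bounded_below:
  assumes "invertible_op A"
  obtains c where "c > 0" "\<And>x. c * norm x \<le> norm (A x)"
proof -
  obtain S where S: "S o\<^sub>L A = id_blinfun" using assms by (auto simp: invertible_op_def)
  \<comment> \<open>The summand 1 keeps the factor positive in the zero space, where
    \<open>S = 0\<close>.\<close>
  have "norm x \<le> (norm S + 1) * norm (A x)" for x
  proof -
    have "norm x = norm (S (A x))" using S by (metis blinfun_apply_blinfun_compose blinfun_apply_id_blinfun id_apply)
    also have "\<dots> \<le> norm S * norm (A x)" by (rule norm_blinfun)
    also have "\<dots> \<le> (norm S + 1) * norm (A x)" by (simp add: mult_right_mono)
    finally show ?thesis .
  qed
  moreover have "norm S + 1 > 0" by (simp add: add_nonneg_pos)
  ultimately show thesis by (intro that[of "1 / (norm S + 1)"]) (auto simp: field_simps)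
qed

lemma approx_eigenvalue_in_spectrum:
  fixes A :: "'a::chilbert_space \<Rightarrow>\<^sub>L 'a"
  assumes "\<And>n. norm (x n) = 1" "(\<lambda>n. A (x n) - l *\<^sub>C x n) \<longlonglongrightarrow> 0"
  shows "l \<in> spectrum A"
  unfolding spectrum_iff
proof
  assume "invertible_op (A - scalar_op l)"
  then obtain c where c: "c > 0" "\<And>x. c * norm x \<le> norm ((A - scalar_op l) x)"
    using invertible_op_bounded_below by blast
  have "c \<le> norm (A (x n) - l *\<^sub>C x n)" for n
    using c(2)[of "x n"] assms(1)[of n] by (simp add: blinfun.diff_left scalar_op.rep_eq)
  then have "c \<le> 0" using tendsto_norm[OF assms(2)] by (intro LIMSEQ_le_const) auto
  with c(1) show False by simp
qed

lemma eigenvalue_in_spectrum: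
  fixes A :: "'a::chilbert_space \<Rightarrow>\<^sub>L 'a"
  assumes "A x = l *\<^sub>C x" "x \<noteq> 0"
  shows "l \<in> spectrum A"
proof (rule approx_eigenvalue_in_spectrum)
  have "A (x /\<^sub>R norm x) = l *\<^sub>C (x /\<^sub>R norm x)"
    by (simp add: blinfun.scaleR_right assms(1) scaleR_scaleC_commute)
  then show "(\<lambda>n::nat. A (x /\<^sub>R norm x) - l *\<^sub>C (x /\<^sub>R norm x)) \<longlonglongrightarrow> 0" by simp
qed (use assms in simp)

lemma sa_shift: "A \<in> self_adjoint_ops \<Longrightarrow> A - scalar_op (of_real t) \<in> self_adjoint_ops"
  by (simp add: scalar_op_of_real)

text \<open>A lower bound alone gives no surjectivity. The square of \<open>A\<close> is coercive,
  because \<open>inner (A (A x)) x\<close> is \<open>(norm (A x))^2\<close>, hence invertible, and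
  \<open>A\<close> is a factor of it.\<close>

lemma sa_invertibleI:
  assumes A: "A \<in> self_adjoint_ops" and c: "c > 0" "\<And>x. c * norm x \<le> norm (A x)"
  shows "invertible_op A"
proof (rule invertible_op_factor[of A A])
  show "invertible_op (A o\<^sub>L A)"
  proof (rule coercive_invertible)
    show "c\<^sup>2 * (norm x)\<^sup>2 \<le> inner ((A o\<^sub>L A) x) x" for x
    proof -
      have "(c * norm x)\<^sup>2 \<le> (norm (A x))\<^sup>2" using c by (intro power_mono) auto
      then show ?thesis by (simp add: power_mult_distrib power2_norm_eq_inner sa_inner[OF A])
    qed
  qed (use A c in \<open>auto intro: sa_bounded\<close>)
qed (use A in \<open>auto intro: sa_bounded\<close>)

text \<open>Weyl's criterion: otherwise the shifted operator would be bounded below by some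
  \<open>inverse (Suc n)\<close> and thus invertible.\<close>

lemma sa_spectrum_approx_eigenvectors:
  assumes A: "A \<in> self_adjoint_ops" and l: "of_real l \<in> spectrum A"
  obtains x where "\<And>n::nat. norm (x n) = 1" "(\<lambda>n. A (x n) - l *\<^sub>R x n) \<longlonglongrightarrow> 0"
proof -
  have "\<exists>x. norm x = 1 \<and> norm (A x - l *\<^sub>R x) < inverse (real (Suc n))" for n
  proof (rule ccontr)
    assume *: "\<nexists>x. norm x = 1 \<and> norm (A x - l *\<^sub>R x) < inverse (real (Suc n))"
    have "invertible_op (A - scalar_op (of_real l))"
    proof (rule sa_invertibleI)
      show "inverse (real (Suc n)) * norm x \<le> norm ((A - scalar_op (of_real l)) x)" for x
      proof (cases "x = 0")
        case False
        then have "inverse (real (Suc n)) \<le> norm (A (x /\<^sub>R norm x) - l *\<^sub>R (x /\<^sub>R norm x))"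
          using * by (metis linorder_not_less norm_sgn sgn_div_norm)
        also have "A (x /\<^sub>R norm x) - l *\<^sub>R (x /\<^sub>R norm x) = (A x - l *\<^sub>R x) /\<^sub>R norm x"
          by (simp add: blinfun.scaleR_right algebra_simps)
        also have "norm \<dots> = norm (A x - l *\<^sub>R x) / norm x" by (simp add: divide_inverse mult.commute)
        finally have "inverse (real (Suc n)) * norm x \<le> norm (A x - l *\<^sub>R x)"
          using False by (metis pos_le_divide_eq zero_less_norm_iff)
        then show ?thesis
          by (simp add: scalar_op_of_real blinfun.bilinear_simps)
      qed simp
    qed (use sa_shift[OF A] in auto)
    with l show False by (simp add: spectrum_iff)
  qed
  then obtain x where x: "\<And>n. norm (x n) = 1" "\<And>n. norm (A (x n) - l *\<^sub>R x n) < inverse (real (Suc n))"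
    by metis
  have "(\<lambda>n. A (x n) - l *\<^sub>R x n) \<longlonglongrightarrow> 0"
    by (rule Lim_null_comparison[OF _ LIMSEQ_inverse_real_of_nat]) (use less_imp_le[OF x(2)] in auto)
  with x(1) show thesis by (rule that)
qed

lemma sa_spectrum_le_norm:
  assumes A: "A \<in> self_adjoint_ops" and l: "of_real l \<in> spectrum A"
  shows "\<bar>l\<bar> \<le> norm A"
proof -
  obtain x where x: "\<And>n::nat. norm (x n) = 1" "(\<lambda>n. A (x n) - l *\<^sub>R x n) \<longlonglongrightarrow> 0"
    using sa_spectrum_approx_eigenvectors[OF A l] by blast
  have "\<bar>l\<bar> - norm A \<le> norm (A (x n) - l *\<^sub>R x n)" for n
    using norm_triangle_ineq2[of "l *\<^sub>R x n" "A (x n)"] norm_blinfun[of A "x n"] x(1)[of n]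
    by (simp add: norm_minus_commute)
  then have "\<bar>l\<bar> - norm A \<le> 0" using tendsto_norm[OF x(2)] by (intro LIMSEQ_le_const) auto
  then show ?thesis by simp
qed

lemma blinfun_norm_attained_approx:
  fixes A :: "'a::real_normed_vector \<Rightarrow>\<^sub>L 'b::real_normed_vector"
  assumes "0 \<le> K" "K < norm A"
  obtains x where "norm x = 1" "K < norm (A x)"
proof (rule ccontr)
  assume "\<not> thesis"
  with that have *: "norm (A x) \<le> K" if "norm x = 1" for x using \<open>norm x = 1\<close> by force
  have "norm A \<le> K"
  proof (rule norm_blinfun_bound[OF assms(1)])
    fix x show "norm (A x) \<le> K * norm x"
    proof (cases "x = 0")
      case False
      then have "norm (A (x /\<^sub>R norm x)) \<le> K" by (intro *) simp
      with False show ?thesis by (simp add: blinfun.scaleR_right field_simps)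
    qed simp
  qed
  with assms show False by simp
qed

text \<open>If both values were missing, \<open>(A - N)(A + N) = A^2 - N^2\<close> would be bounded
  below. Expanding its squared norm keeps \<open>norm (A x)\<close> uniformly below \<open>N\<close>
  on unit vectors, against the choice of \<open>N\<close> as the operator norm.\<close>

lemma sa_norm_in_spectrum:
  assumes A: "A \<in> self_adjoint_ops" and "A \<noteq> 0"
  shows "of_real (norm A) \<in> spectrum A \<or> of_real (- norm A) \<in> spectrum A"
proof (rule ccontr)
  define N where "N = norm A"
  have N: "N > 0" using assms by (simp add: N_def)
  assume "\<not> ?thesis"
  then have "invertible_op ((A - scalar_op (of_real N)) o\<^sub>L (A - scalar_op (of_real (- N))))"
    by (intro invertible_op_comp) (auto simp: spectrum_iff N_def)
  then obtain c where c: "c > 0"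
    "\<And>x. c * norm x \<le> norm (((A - scalar_op (of_real N)) o\<^sub>L (A - scalar_op (of_real (- N)))) x)"
    by (rule invertible_op_bounded_below) blast
  have below: "c * norm x \<le> norm (A (A x) - N\<^sup>2 *\<^sub>R x)" for x
    using c(2)[of x] unfolding scalar_op_of_real
    by (simp add: blinfun.bilinear_simps algebra_simps power2_eq_square)
  define c' where "c' = min c N"
  have c': "0 < c'" "c' \<le> c" "c' \<le> N" using c N by (auto simp: c'_def)
  have up: "(norm (A x))\<^sup>2 \<le> N\<^sup>2 - c'\<^sup>2 / (2 * N\<^sup>2)" if "norm x = 1" for x
  proof -
    have "norm (A (A x)) \<le> N * norm (A x)" using norm_blinfun[of A] by (simp add: N_def)
    then have AA: "(norm (A (A x)))\<^sup>2 \<le> N\<^sup>2 * (norm (A x))\<^sup>2"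
      by (metis power_mono norm_ge_zero power_mult_distrib)
    have "norm (A x) \<le> N" using norm_blinfun[of A x] that by (simp add: N_def)
    then have A1: "(norm (A x))\<^sup>2 \<le> N\<^sup>2" by (simp add: power_mono)
    have "c'\<^sup>2 \<le> (norm (A (A x) - N\<^sup>2 *\<^sub>R x))\<^sup>2"
      using below[of x] that c' by (intro power_mono) auto
    also have "\<dots> = (norm (A (A x)))\<^sup>2 - 2 * N\<^sup>2 * (norm (A x))\<^sup>2 + N\<^sup>2 * N\<^sup>2 * (norm x)\<^sup>2"
      using sa_inner[OF A, of "A x" x]
      by (simp add: power2_norm_eq_inner inner_simps inner_commute)
    also have "\<dots> \<le> N\<^sup>2 * N\<^sup>2 * 2 - 2 * N\<^sup>2 * (norm (A x))\<^sup>2"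
    proof -
      have "(norm (A (A x)))\<^sup>2 \<le> N\<^sup>2 * N\<^sup>2"
        using AA A1 by (meson mult_left_mono order_trans zero_le_power2)
      then show ?thesis using that by simp
    qed
    finally show ?thesis using N by (simp add: field_simps power2_eq_square)
  qed
  define K where "K = sqrt (N\<^sup>2 - c'\<^sup>2 / (2 * N\<^sup>2))"
  have "c'\<^sup>2 / (2 * N\<^sup>2) > 0" using c' N by simp
  then have KN: "K < N" unfolding K_def using N by (intro real_less_lsqrt) auto
  \<comment> \<open>\<open>K\<close> is not known to be nonnegative, as \<open>sqrt\<close> is
    negative on negative arguments.\<close>
  obtain x where x: "norm x = 1" "max 0 K < norm (A x)"
    using blinfun_norm_attained_approx[of "max 0 K" A] KN N by (auto simp: N_def)
  have "norm (A x) \<le> K" unfolding K_def using up[OF x(1)] by (rule real_le_rsqrt)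
  with x show False by simp
qed

section \<open>Polynomials of an operator\<close>

interpretation compose: bounded_bilinear "(o\<^sub>L) :: ('b::real_normed_vector \<Rightarrow>\<^sub>L 'c::real_normed_vector) \<Rightarrow> ('a::real_normed_vector \<Rightarrow>\<^sub>L 'b) \<Rightarrow> _"
  by (rule bounded_bilinear_blinfun_compose)

declare compose.zero_left [simp] compose.zero_right [simp]

lemma poly_op_eq_sum:
  assumes "degree p \<le> n"
  shows "poly_op p A = (\<Sum>i\<le>n. coeff p i *\<^sub>R ((\<lambda>X. A o\<^sub>L X) ^^ i) id_blinfun)"
  unfolding poly_op_def using assms
  by (intro sum.mono_neutral_left) (auto simp: coeff_eq_0)

lemma poly_op_0 [simp]: "poly_op 0 A = 0"
  by (simp add: poly_op_def)

lemma poly_op_pCons [simp]: "poly_op (pCons a p) A = a *\<^sub>R id_blinfun + (A o\<^sub>L poly_op p A)"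
proof -
  have "poly_op (pCons a p) A = (\<Sum>i\<le>Suc (degree p). coeff (pCons a p) i *\<^sub>R ((\<lambda>X. A o\<^sub>L X) ^^ i) id_blinfun)"
    by (rule poly_op_eq_sum) (rule degree_pCons_le)
  then show ?thesis
    by (simp add: sum.atMost_Suc_shift poly_op_def compose.sum_right compose.scaleR_right
        del: sum.atMost_Suc degree_pCons_eq_if)
qed

lemma poly_op_add: "poly_op (p + q) A = poly_op p A + poly_op q A"
  by (simp add: poly_op_eq_sum[of _ "max (degree p) (degree q)"] degree_add_le_max scaleR_left_distrib sum.distrib)

lemma poly_op_smult: "poly_op (smult a p) A = a *\<^sub>R poly_op p A"
  by (simp add: poly_op_eq_sum[of _ "degree p"] degree_smult_le scaleR_sum_right)

lemma poly_op_diff: "poly_op (p - q) A = poly_op p A - poly_op q A"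
  using poly_op_add[of "p - q" q A] by (simp add: algebra_simps)

lemma poly_op_mult: "poly_op (p * q) A = poly_op p A o\<^sub>L poly_op q A"
  by (induction p)
    (simp_all add: mult_pCons_left poly_op_add poly_op_smult compose.add_left compose.scaleR_left
      compose.zero_left blinfun_compose_assoc)

lemma poly_op_commute: "poly_op p A o\<^sub>L poly_op q A = poly_op q A o\<^sub>L poly_op p A"
  by (metis poly_op_mult mult.commute)

lemma poly_op_self_adjoint:
  assumes "A \<in> self_adjoint_ops"
  shows "poly_op p A \<in> self_adjoint_ops"
proof (induction p)
  case (pCons a p)
  have "A o\<^sub>L poly_op p A = poly_op p A o\<^sub>L A"
    using poly_op_commute[of "[:0, 1:]" A p] by (simp add: compose.zero_right)
  then show ?case using assms pCons by (auto intro!: sa_closed sa_compose)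
qed simp

text \<open>A complex root \<open>z\<close> with parts \<open>a\<close>, \<open>b\<close> gives the
  divisor X - a if it is real, and (X - a)^2 + b^2 otherwise. The remainder also vanishes at
  \<open>z\<close>, which its degree permits only if it is zero.\<close>

lemma real_poly_factor_cases:
  fixes p :: "real poly"
  assumes "degree p > 0"
  obtains (linear) t q where "p = [:-t, 1:] * q"
    | (quadratic) a b q where "b \<noteq> 0" "p = [:a\<^sup>2 + b\<^sup>2, - 2 * a, 1:] * q"
proof -
  define ev where "ev z q = poly (map_poly complex_of_real q) z" for z q
  have ev0: "ev z 0 = 0" and ev_pCons: "ev z (pCons c q) = of_real c + z * ev z q" for z c q
    by (simp_all add: ev_def map_poly_pCons)
  have ev_add: "ev z (q + q') = ev z q + ev z q'" for z q q'
    by (induction q q' rule: poly_induct2) (simp_all add: ev0 ev_pCons algebra_simps)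
  have ev_smult: "ev z (smult c q) = of_real c * ev z q" for z c q
    by (induction q) (simp_all add: ev0 ev_pCons algebra_simps)
  have ev_mult: "ev z (q * q') = ev z q * ev z q'" for z q q'
    by (induction q) (simp_all add: ev0 ev_pCons ev_add ev_smult mult_pCons_left algebra_simps)
  have "\<not> constant (poly (map_poly complex_of_real p))"
    using assms by (simp add: constant_degree degree_map_poly)
  then obtain z where z: "ev z p = 0"
    using fundamental_theorem_of_algebra by (auto simp: ev_def)
  define a b where "a = Re z" and "b = Im z"
  define Q where "Q = (if b = 0 then [:-a, 1:] else [:a\<^sup>2 + b\<^sup>2, - 2 * a, 1:])"
  have zeq: "z = Complex a b" by (simp add: a_def b_def)
  have evQ: "ev z Q = 0"
    by (simp add: Q_def ev0 ev_pCons zeq complex_eq_iff power2_eq_square algebra_simps)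
  have Q0: "Q \<noteq> 0" "degree Q = (if b = 0 then 1 else 2)" by (auto simp: Q_def)
  have "ev z (p mod Q) = 0"
    using z evQ ev_add[of z "Q * (p div Q)" "p mod Q"] by (simp add: ev_mult)
  moreover have "degree (p mod Q) < degree Q \<or> p mod Q = 0"
    using Q0 degree_mod_less[of Q p] by auto
  ultimately have "p mod Q = 0"
  proof (cases "b = 0")
    case True
    assume e: "ev z (p mod Q) = 0" and "degree (p mod Q) < degree Q \<or> p mod Q = 0"
    then have "degree (p mod Q) = 0" using Q0 True by auto
    then obtain r where "p mod Q = [:r:]" by (rule degree_eq_zeroE)
    with e show ?thesis by (simp add: ev0 ev_pCons)
  next
    case False
    assume e: "ev z (p mod Q) = 0" and "degree (p mod Q) < degree Q \<or> p mod Q = 0"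
    then have "degree (p mod Q) \<le> 1" using Q0 False by auto
    then obtain r s where rs: "p mod Q = [:r, s:]"
      by (metis One_nat_def degree_pCons_eq_if degree_eq_zeroE le_zero_eq not_less_eq_eq pCons_cases Suc_le_mono pCons_0_0)
    with e have "of_real r + z * of_real s = 0" by (simp add: ev0 ev_pCons)
    with False have "s = 0" "r = 0" by (auto simp: zeq complex_eq_iff)
    with rs show ?thesis by simp
  qed
  then have "p = Q * (p div Q)" using div_mult_mod_eq[of p Q] by (simp add: mult.commute)
  then show thesis using linear[of a "p div Q"] quadratic[of b a "p div Q"] by (auto simp: Q_def split: if_splits)
qed

text \<open>Half of the spectral mapping theorem, factor by factor: real roots lie outside the
  spectrum by assumption, and quadratic factors without real roots are coercive on any self-adjoint
  operator.\<close>

lemma poly_op_invertible: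
  assumes A: "A \<in> self_adjoint_ops"
    and "\<And>t. of_real t \<in> spectrum A \<Longrightarrow> poly p t \<noteq> 0" and "p \<noteq> 0"
  shows "invertible_op (poly_op p A)"
  using assms(2,3)
proof (induction "degree p" arbitrary: p rule: less_induct)
  case less
  show ?case
  proof (cases "degree p = 0")
    case True
    then obtain c where c: "p = [:c:]" by (rule degree_eq_zeroE)
    then have "c \<noteq> 0" using less.prems by auto
    then have "(1 / c) *\<^sub>R id_blinfun o\<^sub>L poly_op p A = id_blinfun" "poly_op p A o\<^sub>L (1 / c) *\<^sub>R id_blinfun = id_blinfun"
      by (auto simp: c compose.zero_right blinfun.bilinear_simps intro!: blinfun_eqI)
    then show ?thesis unfolding invertible_op_def by blast
  next
    case False
    have step: "invertible_op (poly_op p A)"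
      if p: "p = Q * q" and Q: "invertible_op (poly_op Q A)" "degree Q > 0" for Q q
    proof -
      have nz: "Q \<noteq> 0" "q \<noteq> 0" using less.prems p by auto
      then have "degree q < degree p" using p Q by (simp add: degree_mult_eq)
      then have "invertible_op (poly_op q A)" using less.prems nz by (intro less.hyps) (auto simp: p)
      with Q show ?thesis by (simp add: p poly_op_mult invertible_op_comp)
    qed
    show ?thesis using False[unfolded neq0_conv]
    proof (cases p rule: real_poly_factor_cases)
      case (linear t q)
      then have "of_real t \<notin> spectrum A" using less.prems(1)[of t] by auto
      then have inv: "invertible_op (poly_op [:-t, 1:] A)"
        by (simp add: spectrum_iff scalar_op_of_real compose.zero_right algebra_simps)
      show ?thesis by (rule step[OF linear inv]) simp
    next
      case (quadratic a b q)
      have inv: "invertible_op (poly_op [:a\<^sup>2 + b\<^sup>2, - 2 * a, 1:] A)"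
      proof (rule coercive_invertible)
        show "b\<^sup>2 > 0" using quadratic by simp
        show "b\<^sup>2 * (norm x)\<^sup>2 \<le> inner (poly_op [:a\<^sup>2 + b\<^sup>2, - 2 * a, 1:] A x) x" for x
        proof -
          \<comment> \<open>The operator is \<open>(A - a)^2 + b^2\<close>, and symmetry turns the
            form of the square into a squared norm.\<close>
          have "0 \<le> (norm (A x - a *\<^sub>R x))\<^sup>2" by simp
          also have "\<dots> = inner (poly_op [:a\<^sup>2 + b\<^sup>2, - 2 * a, 1:] A x) x - b\<^sup>2 * (norm x)\<^sup>2"
            using sa_inner[OF A, of "A x" x]
            by (simp add: power2_norm_eq_inner blinfun.bilinear_simps inner_simps inner_commute algebra_simps)
              (simp add: power2_eq_square)
          finally show ?thesis by simp
        qed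
      qed (intro sa_bounded poly_op_self_adjoint A)
      show ?thesis by (rule step[OF quadratic(2) inv]) simp
    qed
  qed
qed

text \<open>\<open>poly_op p A\<close> is self-adjoint, so if nonzero it has its norm, up to sign,
  as a spectral value; every real spectral value of it is a value of \<open>p\<close> on the
  spectrum of \<open>A\<close>.\<close>

lemma poly_op_norm_le:
  assumes A: "A \<in> self_adjoint_ops" and K: "0 \<le> K"
    and le: "\<And>t. of_real t \<in> spectrum A \<Longrightarrow> \<bar>poly p t\<bar> \<le> K"
  shows "norm (poly_op p A) \<le> K"
proof (rule ccontr)
  assume "\<not> ?thesis"
  then have gt: "norm (poly_op p A) > K" by simp
  have "poly_op p A \<noteq> 0" using gt K by auto
  then obtain l where l: "of_real l \<in> spectrum (poly_op p A)" "\<bar>l\<bar> > K"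
    using sa_norm_in_spectrum[OF poly_op_self_adjoint[OF A]] gt K by (metis abs_minus_cancel abs_norm_cancel)
  have "poly_op p A - scalar_op (of_real l) = poly_op (p - [:l:]) A"
    by (simp add: scalar_op_of_real poly_op_diff compose.zero_right)
  then have ni: "\<not> invertible_op (poly_op (p - [:l:]) A)" using l by (simp add: spectrum_iff)
  have "\<exists>t. of_real t \<in> spectrum A \<and> poly p t = l"
  proof (cases "p = [:l:]")
    case True
    \<comment> \<open>For constant \<open>p\<close> any real spectral point will do. If
      \<open>A = 0\<close>, the point is 0, which requires a nonzero space; \<open>ni\<close>
      supplies this, as it says here that the zero operator is not invertible.\<close>
    have "A \<noteq> 0 \<or> A = 0" by simp
    then have "\<exists>t. of_real t \<in> spectrum A"
    proof
      assume "A = 0"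
      have "\<not> invertible_op (0 :: 'a \<Rightarrow>\<^sub>L 'a)" using ni True by simp
      then have "of_real 0 \<in> spectrum A" using \<open>A = 0\<close> by (simp add: spectrum_iff scalar_op_of_real del: of_real_0)
      then show ?thesis by blast
    qed (use sa_norm_in_spectrum[OF A] in blast)
    then show ?thesis using True by auto
  next
    case False
    then show ?thesis using poly_op_invertible[OF A, of "p - [:l:]"] ni by auto
  qed
  with le l show False by force
qed

section \<open>Functional calculus\<close>

lemma polynomial_approximation:
  fixes f :: "real \<Rightarrow> real"
  assumes "continuous_on {a..b} f" "e > 0"
  obtains p where "\<And>x. x \<in> {a..b} \<Longrightarrow> \<bar>f x - poly p x\<bar> < e"
proof -
  have "\<exists>g. (\<exists>p. g = poly p) \<and> (\<forall>x\<in>{a..b}. \<bar>f x - g x\<bar> < e)"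
  proof (rule Stone_Weierstrass_HOL)
    show "\<exists>p. (\<lambda>x. c) = poly p" for c :: real by (rule exI[of _ "[:c:]"]) auto
    show "\<exists>p. (\<lambda>x. f x + g x) = poly p" if "(\<exists>p. f = poly p) \<and> (\<exists>p. g = poly p)" for f g :: "real \<Rightarrow> real"
      using that by (auto simp flip: poly_add)
    show "\<exists>p. (\<lambda>x. f x * g x) = poly p" if "(\<exists>p. f = poly p) \<and> (\<exists>p. g = poly p)" for f g :: "real \<Rightarrow> real"
      using that by (auto simp flip: poly_mult)
    show "\<exists>f. (\<exists>p. f = poly p) \<and> f x \<noteq> f y" if "x \<in> {a..b} \<and> y \<in> {a..b} \<and> x \<noteq> y" for x y :: real
      using that by (intro exI[of _ "poly [:0, 1:]"]) auto
  qed (use assms in \<open>auto intro!: continuous_intros\<close>)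
  then show thesis using that by blast
qed

lemma polynomial_uniform_limit:
  fixes f :: "real \<Rightarrow> real"
  assumes "continuous_on {a..b} f"
  obtains q where "uniform_limit {a..b} (\<lambda>n. poly (q n)) f sequentially"
proof -
  have "\<exists>p. \<forall>x\<in>{a..b}. \<bar>f x - poly p x\<bar> < inverse (real (Suc n))" for n
    by (rule polynomial_approximation[OF assms, of "inverse (real (Suc n))"]) (simp, blast)
  then obtain q where q: "\<And>n x. x \<in> {a..b} \<Longrightarrow> \<bar>f x - poly (q n) x\<bar> < inverse (real (Suc n))"
    by metis
  have "uniform_limit {a..b} (\<lambda>n. poly (q n)) f sequentially"
    unfolding uniform_limit_iff
  proof (intro allI impI)
    fix e :: real assume "e > 0"
    then have "\<forall>\<^sub>F n in sequentially. inverse (real (Suc n)) < e"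
      using order_tendstoD(2)[OF LIMSEQ_inverse_real_of_nat] by blast
    then show "\<forall>\<^sub>F n in sequentially. \<forall>x\<in>{a..b}. dist (poly (q n) x) (f x) < e"
      by eventually_elim (metis q dist_real_def abs_minus_commute order.strict_trans)
  qed
  then show thesis by (rule that)
qed

text \<open>With \<open>p = q\<close> this makes the operator sequence Cauchy; with two sequences it
  makes the limit independent of the choice.\<close>

lemma poly_op_uniform_close:
  assumes A: "A \<in> self_adjoint_ops"
    and p: "uniform_limit {t. of_real t \<in> spectrum A} (\<lambda>n. poly (p n)) f sequentially"
    and q: "uniform_limit {t. of_real t \<in> spectrum A} (\<lambda>n. poly (q n)) f sequentially"
    and e: "e > 0"
  shows "\<exists>N. \<forall>m\<ge>N. \<forall>n\<ge>N. norm (poly_op (p m) A - poly_op (q n) A) < e"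
proof -
  have "\<forall>\<^sub>F n in sequentially. \<forall>t\<in>{t. of_real t \<in> spectrum A}. dist (poly (p n) t) (f t) < e / 4"
    using uniform_limitD[OF p, of "e / 4"] e by simp
  moreover have "\<forall>\<^sub>F n in sequentially. \<forall>t\<in>{t. of_real t \<in> spectrum A}. dist (poly (q n) t) (f t) < e / 4"
    using uniform_limitD[OF q, of "e / 4"] e by simp
  ultimately obtain N where N: "\<And>n t. n \<ge> N \<Longrightarrow> of_real t \<in> spectrum A \<Longrightarrow>
      dist (poly (p n) t) (f t) < e / 4 \<and> dist (poly (q n) t) (f t) < e / 4"
    unfolding eventually_sequentially by (metis mem_Collect_eq nle_le order.trans)
  have "norm (poly_op (p m) A - poly_op (q n) A) < e" if "m \<ge> N" "n \<ge> N" for m n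
  proof -
    have "norm (poly_op (p m - q n) A) \<le> e / 2"
    proof (rule poly_op_norm_le[OF A])
      fix t :: real assume "of_real t \<in> spectrum A"
      then show "\<bar>poly (p m - q n) t\<bar> \<le> e / 2"
        using N[OF that(1), of t] N[OF that(2), of t] e unfolding dist_real_def poly_diff by linarith
    qed (use e in simp)
    then show ?thesis using e by (simp add: poly_op_diff)
  qed
  then show ?thesis by blast
qed

text \<open>Justifies the definite description in \<open>cfc\<close>. Continuity on an interval
  containing the real spectral points provides an approximating sequence; without one, every
  operator would satisfy the defining condition vacuously.\<close>

lemma cfc_tendsto:
  assumes A: "A \<in> self_adjoint_ops" and sp: "{t. of_real t \<in> spectrum A} \<subseteq> {a..b}"
    and f: "continuous_on {a..b} f"
    and p: "uniform_limit {t. of_real t \<in> spectrum A} (\<lambda>n. poly (p n)) f sequentially"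
  shows "(\<lambda>n. poly_op (p n) A) \<longlonglongrightarrow> cfc f A"
proof -
  let ?\<sigma> = "{t. complex_of_real t \<in> spectrum A}"
  obtain q where q: "uniform_limit ?\<sigma> (\<lambda>n. poly (q n)) f sequentially"
    using polynomial_uniform_limit[OF f] uniform_limit_on_subset[OF _ sp] by metis
  have "Cauchy (\<lambda>n. poly_op (q n) A)"
    using poly_op_uniform_close[OF A q q] by (intro metric_CauchyI) (simp add: dist_norm)
  then obtain X where X: "(\<lambda>n. poly_op (q n) A) \<longlonglongrightarrow> X"
    using Cauchy_convergent convergent_def by blast
  have all: "(\<lambda>n. poly_op (p' n) A) \<longlonglongrightarrow> X"
    if p': "uniform_limit ?\<sigma> (\<lambda>n. poly (p' n)) f sequentially" for p'
  proof -
    have "(\<lambda>n. poly_op (p' n) A - poly_op (q n) A) \<longlonglongrightarrow> 0"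
      using poly_op_uniform_close[OF A p' q] by (intro LIMSEQ_I) force
    from tendsto_add[OF this X] show ?thesis by simp
  qed
  have "cfc f A = X"
    unfolding cfc_def by (rule the_equality) (use all q LIMSEQ_unique X in blast)+
  then show ?thesis using all[OF p] by simp
qed

lemma cfc_limit:
  assumes "A \<in> self_adjoint_ops" "{t. of_real t \<in> spectrum A} \<subseteq> {a..b}" "continuous_on {a..b} f"
  obtains q where "uniform_limit {t. of_real t \<in> spectrum A} (\<lambda>n. poly (q n)) f sequentially"
    "(\<lambda>n. poly_op (q n) A) \<longlonglongrightarrow> cfc f A"
  using polynomial_uniform_limit[OF assms(3)] uniform_limit_on_subset[OF _ assms(2)] cfc_tendsto[OF assms]
  by metis

lemma cfc_self_adjoint:
  assumes "A \<in> self_adjoint_ops" "{t. of_real t \<in> spectrum A} \<subseteq> {a..b}" "continuous_on {a..b} f"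
  shows "cfc f A \<in> self_adjoint_ops"
  using cfc_limit[OF assms] sa_limit poly_op_self_adjoint[OF assms(1)] by metis

text \<open>The polynomial estimate survives the limit. With \<open>K = 0\<close> it identifies
  \<open>f(A)\<close>; with a constant polynomial it yields positivity of the absolute
  value.\<close>

lemma cfc_poly_dist:
  assumes A: "A \<in> self_adjoint_ops" "{t. of_real t \<in> spectrum A} \<subseteq> {a..b}" "continuous_on {a..b} f"
    and K: "0 \<le> K" "\<And>t. of_real t \<in> spectrum A \<Longrightarrow> \<bar>f t - poly p t\<bar> \<le> K"
  shows "norm (cfc f A - poly_op p A) \<le> K"
proof (rule field_le_epsilon)
  fix e :: real assume e: "e > 0"
  obtain q where q: "uniform_limit {t. of_real t \<in> spectrum A} (\<lambda>n. poly (q n)) f sequentially"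
    "(\<lambda>n. poly_op (q n) A) \<longlonglongrightarrow> cfc f A"
    using cfc_limit[OF A] by blast
  have "\<forall>\<^sub>F n in sequentially. norm (poly_op (q n) A - poly_op p A) \<le> K + e"
    using uniform_limitD[OF q(1) e]
  proof eventually_elim
    case (elim n)
    have "norm (poly_op (q n - p) A) \<le> K + e"
    proof (rule poly_op_norm_le[OF A(1)])
      fix t :: real assume "of_real t \<in> spectrum A"
      then show "\<bar>poly (q n - p) t\<bar> \<le> K + e"
        using elim K(2)[of t] by (force simp: dist_real_def)
    qed (use e K in simp)
    then show ?case by (simp add: poly_op_diff)
  qed
  then show "norm (cfc f A - poly_op p A) \<le> K + e"
    by (intro tendsto_upperbound[OF tendsto_norm[OF tendsto_diff[OF q(2) tendsto_const]]]) auto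
qed

lemma cfc_eq_poly_op:
  assumes "A \<in> self_adjoint_ops" "{t. of_real t \<in> spectrum A} \<subseteq> {a..b}" "continuous_on {a..b} f"
    and "\<And>t. of_real t \<in> spectrum A \<Longrightarrow> f t = poly p t"
  shows "cfc f A = poly_op p A"
  using cfc_poly_dist[OF assms(1-3), of 0 p] assms(4) by simp

lemma poly_op_approx_eigenvector:
  fixes A :: "'a::chilbert_space \<Rightarrow>\<^sub>L 'a"
  assumes "(\<lambda>n. A (x n) - l *\<^sub>R x n) \<longlonglongrightarrow> 0"
  shows "(\<lambda>n. poly_op p A (x n) - poly p l *\<^sub>R x n) \<longlonglongrightarrow> 0"
proof (induction p)
  case (pCons a p)
  have "(\<lambda>n. A (poly_op p A (x n) - poly p l *\<^sub>R x n) + poly p l *\<^sub>R (A (x n) - l *\<^sub>R x n)) \<longlonglongrightarrow> A 0 + poly p l *\<^sub>R 0"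
    by (intro tendsto_intros pCons assms)
  then show ?case
    by (simp add: blinfun.bilinear_simps algebra_simps)
qed simp

text \<open>Replace \<open>f\<close> by a close polynomial, both in the operator and at
  \<open>l\<close>, and use the polynomial case in between. The vectors \<open>x\<close> are
  unchanged, so the result can be iterated over several functions.\<close>

lemma cfc_approx_eigenvector:
  assumes A: "A \<in> self_adjoint_ops" "{t. of_real t \<in> spectrum A} \<subseteq> {a..b}" "continuous_on {a..b} f"
    and x: "\<And>n. norm (x n) = 1" "(\<lambda>n. A (x n) - l *\<^sub>R x n) \<longlonglongrightarrow> 0"
  shows "(\<lambda>n. cfc f A (x n) - f l *\<^sub>R x n) \<longlonglongrightarrow> 0"
proof (rule LIMSEQ_I)
  fix e :: real assume e: "e > 0"
  have l: "l \<in> {a..b}"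
    using approx_eigenvalue_in_spectrum[of x A "of_real l"] x A(2) by (auto simp: scaleC_of_real)
  obtain p where p: "\<And>t. t \<in> {a..b} \<Longrightarrow> \<bar>f t - poly p t\<bar> < e / 3"
    using polynomial_approximation[OF A(3), of "e / 3"] e by auto
  have "norm (cfc f A - poly_op p A) \<le> e / 3"
    by (rule cfc_poly_dist[OF A]) (use A(2) e less_imp_le[OF p] in auto)
  then have d: "norm (cfc f A (x n) - poly_op p A (x n)) \<le> e / 3" for n
    using norm_blinfun[of "cfc f A - poly_op p A" "x n"] x(1)[of n] by (simp add: blinfun.diff_left)
  obtain N where N: "\<And>n. n \<ge> N \<Longrightarrow> norm (poly_op p A (x n) - poly p l *\<^sub>R x n) < e / 3"
    using LIMSEQ_D[OF poly_op_approx_eigenvector[OF x(2), of p], of "e / 3"] e by auto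
  have "norm (cfc f A (x n) - f l *\<^sub>R x n - 0) < e" if "n \<ge> N" for n
  proof -
    have "norm (poly p l *\<^sub>R x n - f l *\<^sub>R x n) < e / 3"
      using p[OF l] x(1)[of n] by (simp add: abs_minus_commute flip: scaleR_diff_left)
    then have "norm (cfc f A (x n) - poly_op p A (x n)) + norm (poly_op p A (x n) - poly p l *\<^sub>R x n)
        + norm (poly p l *\<^sub>R x n - f l *\<^sub>R x n) < e"
      using d[of n] N[OF that] by simp
    moreover have "cfc f A (x n) - f l *\<^sub>R x n = (cfc f A (x n) - poly_op p A (x n))
        + (poly_op p A (x n) - poly p l *\<^sub>R x n) + (poly p l *\<^sub>R x n - f l *\<^sub>R x n)" by simp
    ultimately show ?thesis
      using norm_triangle_mono[OF norm_triangle_ineq order_refl,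
          of "cfc f A (x n) - poly_op p A (x n)" "poly_op p A (x n) - poly p l *\<^sub>R x n" "poly p l *\<^sub>R x n - f l *\<^sub>R x n"]
      by simp
  qed
  then show "\<exists>N. \<forall>n\<ge>N. norm (cfc f A (x n) - f l *\<^sub>R x n - 0) < e" by blast
qed

section \<open>Positivity and powers of the absolute value\<close>

lemma nonneg_spectrum:
  assumes A: "A \<in> self_adjoint_ops" and pos: "\<And>x. 0 \<le> inner (A x) x"
  shows "{t. of_real t \<in> spectrum A} \<subseteq> {0..norm A}"
proof
  fix t :: real assume "t \<in> {t. of_real t \<in> spectrum A}"
  then have t: "of_real t \<in> spectrum A" by simp
  have "0 \<le> t"
  proof (rule ccontr)
    assume "\<not> 0 \<le> t"
    \<comment> \<open>For negative \<open>t\<close> the shift adds \<open>- t * (norm x)^2\<close>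
      to a nonnegative form, hence coercivity with constant \<open>- t\<close>.\<close>
    then have "invertible_op (A - scalar_op (of_real t))"
      by (intro coercive_invertible[of _ "- t"])
        (use pos sa_shift[OF A] in \<open>auto simp: scalar_op_of_real blinfun.bilinear_simps inner_simps power2_norm_eq_inner intro!: sa_bounded\<close>)
    with t show False by (simp add: spectrum_iff)
  qed
  with sa_spectrum_le_norm[OF A t] show "t \<in> {0..norm A}" by simp
qed

lemma continuous_on_powr_nonneg: "r > 0 \<Longrightarrow> continuous_on {0..b} (\<lambda>t::real. t powr r)"
  by (intro continuous_on_powr' continuous_intros) auto

lemma square_sa:
  assumes "A \<in> self_adjoint_ops"
  shows "A o\<^sub>L A \<in> self_adjoint_ops" "{t. of_real t \<in> spectrum (A o\<^sub>L A)} \<subseteq> {0..norm (A o\<^sub>L A)}"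
proof -
  show sa: "A o\<^sub>L A \<in> self_adjoint_ops" by (intro sa_compose assms refl)
  show "{t. of_real t \<in> spectrum (A o\<^sub>L A)} \<subseteq> {0..norm (A o\<^sub>L A)}"
    by (rule nonneg_spectrum[OF sa]) (simp add: sa_inner[OF assms, of "A _"])
qed

lemma abs_op_eq: "A \<in> self_adjoint_ops \<Longrightarrow> abs_op A = cfc sqrt (A o\<^sub>L A)"
  by (simp add: abs_op_def self_adjoint_ops_def)

lemma abs_op_sa:
  assumes A: "A \<in> self_adjoint_ops"
  shows "abs_op A \<in> self_adjoint_ops" "{t. of_real t \<in> spectrum (abs_op A)} \<subseteq> {0..norm (abs_op A)}"
proof -
  note sq = square_sa[OF A]
  have cont: "continuous_on {0..norm (A o\<^sub>L A)} sqrt" by (intro continuous_intros)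
  show sa: "abs_op A \<in> self_adjoint_ops"
    unfolding abs_op_eq[OF A] by (rule cfc_self_adjoint[OF sq cont])
  \<comment> \<open>On the spectrum of the square, \<open>sqrt\<close> takes values between 0 and
    \<open>c\<close>, so it stays within \<open>c\<close> of the constant \<open>c\<close>. An
    operator within distance \<open>c\<close> of \<open>c\<close> times the identity has a
    nonnegative form.\<close>
  define c where "c = sqrt (norm (A o\<^sub>L A))"
  have "norm (abs_op A - poly_op [:c:] (A o\<^sub>L A)) \<le> c"
    unfolding abs_op_eq[OF A]
  proof (rule cfc_poly_dist[OF sq cont])
    fix t :: real assume "of_real t \<in> spectrum (A o\<^sub>L A)"
    then have "0 \<le> t" "t \<le> norm (A o\<^sub>L A)" using sq(2) by auto
    then show "\<bar>sqrt t - poly [:c:] t\<bar> \<le> c" by (simp add: c_def)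
  qed (simp add: c_def)
  then have n: "norm (abs_op A - c *\<^sub>R id_blinfun) \<le> c" by simp
  show "{t. of_real t \<in> spectrum (abs_op A)} \<subseteq> {0..norm (abs_op A)}"
  proof (rule nonneg_spectrum[OF sa])
    fix x
    have "inner (c *\<^sub>R x - abs_op A x) x \<le> norm (c *\<^sub>R x - abs_op A x) * norm x"
      by (rule norm_cauchy_schwarz)
    also have "norm (c *\<^sub>R x - abs_op A x) = norm ((abs_op A - c *\<^sub>R id_blinfun) x)"
      by (simp add: blinfun.bilinear_simps norm_minus_commute)
    also have "\<dots> \<le> c * norm x"
      using norm_blinfun[of "abs_op A - c *\<^sub>R id_blinfun" x] n by (meson mult_right_mono norm_ge_zero order_trans)
    finally have "inner (c *\<^sub>R x - abs_op A x) x \<le> c * (norm x)\<^sup>2"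
      by (simp add: mult_right_mono power2_eq_square mult.assoc[symmetric])
    then show "0 \<le> inner (abs_op A x) x"
      by (simp add: inner_simps power2_norm_eq_inner)
  qed
qed

lemma approx_eigenvector_compose:
  fixes A B :: "'a::real_normed_vector \<Rightarrow>\<^sub>L 'a"
  assumes "(\<lambda>n. A (x n) - a *\<^sub>R x n) \<longlonglongrightarrow> 0" "(\<lambda>n. B (x n) - b *\<^sub>R x n) \<longlonglongrightarrow> 0"
  shows "(\<lambda>n. (A o\<^sub>L B) (x n) - (a * b) *\<^sub>R x n) \<longlonglongrightarrow> 0"
proof -
  have "(\<lambda>n. A (B (x n) - b *\<^sub>R x n) + b *\<^sub>R (A (x n) - a *\<^sub>R x n)) \<longlonglongrightarrow> A 0 + b *\<^sub>R 0"
    by (intro tendsto_intros assms)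
  then show ?thesis by (simp add: blinfun.bilinear_simps algebra_simps)
qed

text \<open>The same unit vectors pass through the square, \<open>sqrt\<close> and the power, with
  values \<open>l * l\<close>, \<open>\<bar>l\<bar>\<close> and
  \<open>\<bar>l\<bar> powr of_rat r\<close>.\<close>

lemma abs_power_approx_eigenvector:
  assumes A: "A \<in> self_adjoint_ops" and r: "r > 0"
    and x: "\<And>n. norm (x n) = 1" "(\<lambda>n. A (x n) - l *\<^sub>R x n) \<longlonglongrightarrow> 0"
  shows "(\<lambda>n. abs_power A r (x n) - (\<bar>l\<bar> powr of_rat r) *\<^sub>R x n) \<longlonglongrightarrow> 0"
proof -
  have "(\<lambda>n. abs_op A (x n) - sqrt (l * l) *\<^sub>R x n) \<longlonglongrightarrow> 0"
    unfolding abs_op_eq[OF A]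
    by (rule cfc_approx_eigenvector[OF square_sa[OF A] _ x(1)])
      (intro continuous_intros, rule approx_eigenvector_compose[OF x(2) x(2)])
  then have *: "(\<lambda>n. abs_op A (x n) - \<bar>l\<bar> *\<^sub>R x n) \<longlonglongrightarrow> 0" by simp
  show ?thesis unfolding abs_power_def
    by (rule cfc_approx_eigenvector[OF abs_op_sa[OF A] continuous_on_powr_nonneg x(1) *]) (use r in simp)
qed

lemma invertible_scalar_op: "k \<noteq> 0 \<Longrightarrow> invertible_op (scalar_op k)"
  unfolding invertible_op_def
  by (rule bexI[of _ "scalar_op (inverse k)"])
    (auto intro!: blinfun_eqI simp: scalar_op.rep_eq scaleC_scaleC)

text \<open>With \<open>m = t - l\<close> the hypothesis gives
  \<open>(X - l)(X - m) = l * m\<close>, an invertible scalar unless \<open>l\<close> is 0 or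
  \<open>t\<close>.\<close>

lemma quadratic_spectrum:
  assumes X: "X \<in> bounded_ops" "X o\<^sub>L X = t *\<^sub>R X"
  shows "spectrum X \<subseteq> {0, of_real t}"
proof
  fix l assume l: "l \<in> spectrum X"
  define m where "m = of_real t - l"
  have XX: "X (X x) = l *\<^sub>C X x + m *\<^sub>C X x" for x
    using X(2) scaleC_add_left[of l m "X x"]
    by (metis m_def add_diff_cancel_left' add_diff_eq blinfun_apply_blinfun_compose blinfun.scaleR_left scaleC_of_real)
  have "(X - scalar_op l) o\<^sub>L (X - scalar_op m) = scalar_op (l * m)"
    "(X - scalar_op m) o\<^sub>L (X - scalar_op l) = scalar_op (l * m)"
    by (auto intro!: blinfun_eqI simp: blinfun.bilinear_simps scalar_op.rep_eq XX
        bounded_opsD[OF X(1)] scaleC_diff_right scaleC_scaleC mult.commute)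
  then have "l * m = 0"
    using l invertible_op_factor[of "X - scalar_op l" "X - scalar_op m"] X(1)
    by (metis spectrum_iff invertible_scalar_op bounded_ops_closed(3,5))
  then show "l \<in> {0, of_real t}" by (auto simp: m_def)
qed

lemma idempotent_spectrum:
  assumes "P \<in> bounded_ops" "P o\<^sub>L P = P"
  shows "spectrum P \<subseteq> {0, 1}"
  using quadratic_spectrum[of P 1] assms by simp

text \<open>On {0, 1} the square root and all positive powers agree with the polynomial
  \<open>[:0, 1:]\<close>. This removes the exponents from the spectral hypothesis for projections
  and the identity.\<close>

lemma abs_power_idempotent:
  assumes P: "P \<in> self_adjoint_ops" "P o\<^sub>L P = P" and r: "r > 0"
  shows "abs_power P r = P"
proof -
  have sp: "t = 0 \<or> t = 1" if "of_real t \<in> spectrum P" for t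
    using idempotent_spectrum[OF sa_bounded[OF P(1)] P(2)] that by auto
  have sub: "{t. of_real t \<in> spectrum P} \<subseteq> {0..1}" using sp by force
  have "abs_op P = poly_op [:0, 1:] P"
    unfolding abs_op_eq[OF P(1)] P(2)
    by (rule cfc_eq_poly_op[OF P(1) sub]) (use sp in \<open>force intro!: continuous_intros\<close>)+
  then have "abs_op P = P" by simp
  then have "abs_power P r = poly_op [:0, 1:] P"
    unfolding abs_power_def
    using r by (simp only:) (rule cfc_eq_poly_op[OF P(1) sub continuous_on_powr_nonneg], simp, drule sp, auto)
  then show ?thesis by simp
qed

text \<open>By the norm estimate with bound 0, a polynomial vanishing on the spectrum annihilates
  the operator: X - 1 here, X^2 - X in the next lemma.\<close>

lemma sa_eq_id:
  assumes "A \<in> self_adjoint_ops" "\<And>t. of_real t \<in> spectrum A \<Longrightarrow> t = 1"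
  shows "A = id_blinfun"
  using poly_op_norm_le[OF assms(1), of 0 "[:-1, 1:]"] assms(2) by simp

lemma sa_idempotentI:
  assumes "A \<in> self_adjoint_ops" "spectrum A \<subseteq> {0, 1}"
  shows "A o\<^sub>L A = A"
proof -
  have "norm (poly_op [:0, -1, 1:] A) \<le> 0"
    by (rule poly_op_norm_le[OF assms(1)]) (use assms(2) in auto)
  then show ?thesis by (simp add: compose.diff_right)
qed

text \<open>A real spectral point \<open>t\<close> of \<open>A\<close> makes
  \<open>t * \<bar>t\<bar> powr (r + s)\<close> a spectral point of the product, and this is 1 only
  for \<open>t = 1\<close>. The inclusion in the hypothesis covers the zero space, where spectra are
  empty.\<close>

lemma abs_power_sandwich_eq_id:
  assumes A: "A \<in> self_adjoint_ops" and r: "r > 0" and s: "s > 0"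
    and sp: "spectrum (abs_power A r o\<^sub>L A o\<^sub>L abs_power A s) \<subseteq> {1}"
  shows "A = id_blinfun"
proof (rule sa_eq_id[OF A])
  fix t :: real assume "of_real t \<in> spectrum A"
  then obtain x where x: "\<And>n::nat. norm (x n) = 1" "(\<lambda>n. A (x n) - t *\<^sub>R x n) \<longlonglongrightarrow> 0"
    using sa_spectrum_approx_eigenvectors[OF A] by blast
  let ?m = "\<bar>t\<bar> powr of_rat r * t * \<bar>t\<bar> powr of_rat s"
  have "(\<lambda>n. (abs_power A r o\<^sub>L A o\<^sub>L abs_power A s) (x n) - ?m *\<^sub>R x n) \<longlonglongrightarrow> 0"
    by (intro approx_eigenvector_compose abs_power_approx_eigenvector A r s x)
  then have "of_real ?m \<in> spectrum (abs_power A r o\<^sub>L A o\<^sub>L abs_power A s)"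
    by (intro approx_eigenvalue_in_spectrum[OF x(1)]) (simp only: scaleC_of_real)
  with sp have m: "?m = 1" by (auto simp del: of_real_mult)
  then have "t > 0" by (smt (verit) mult_nonneg_nonpos mult_nonpos_nonneg powr_ge_zero)
  with m have "t powr (of_rat r + 1 + of_rat s) = 1" by (simp add: powr_add)
  moreover have "0 < real_of_rat r" "0 < real_of_rat s" using r s by simp_all
  ultimately show "t = 1" using \<open>t > 0\<close> by (smt (verit) powr_less_mono2 powr_one_eq_one powr_eq_one_iff_gen)
qed

section \<open>Rank-one projections\<close>

text \<open>The phase \<open>k\<close> makes the inner product real and nonnegative, reducing the
  claim to the real Cauchy-Schwarz inequality.\<close>

lemma cmod_cinner_le: "cmod (cinner x y) \<le> norm x * norm (y::'a::complex_inner)"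
proof (cases "cinner x y = 0")
  case False
  define k where "k = cnj (sgn (cinner x y))"
  have k: "cmod k = 1" using False by (simp add: k_def norm_sgn)
  have "k * cinner x y = of_real (cmod (cinner x y))"
    using False by (simp add: k_def sgn_eq complex_norm_square power2_eq_square mult.commute field_simps
        flip: complex_norm_square)
  then have "cmod (cinner x y) = inner (k *\<^sub>C x) y"
    by (simp add: inner_eq_Re_cinner cinner_scaleC_left)
  also have "\<dots> \<le> norm (k *\<^sub>C x) * norm y" by (rule norm_cauchy_schwarz)
  finally show ?thesis by (simp add: norm_scaleC k)
qed simp

text \<open>The projection onto the line of \<open>x\<close>, scaled by \<open>(norm x)^2\<close>.
  Admitting all vectors makes it quadratic in \<open>x\<close>, so that it can be polarized.\<close>

lift_definition rank1 :: "'a::complex_inner \<Rightarrow> 'a \<Rightarrow>\<^sub>L 'a" is "\<lambda>x z. cinner z x *\<^sub>C x"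
proof (rule bounded_linear_intro)
  fix x z z' :: 'a and t :: real
  show "cinner (z + z') x *\<^sub>C x = cinner z x *\<^sub>C x + cinner z' x *\<^sub>C x"
    by (simp add: cinner_add_left scaleC_add_left)
  show "cinner (t *\<^sub>R z) x *\<^sub>C x = t *\<^sub>R (cinner z x *\<^sub>C x)"
    by (simp add: cinner_scaleR_left scaleC_of_real flip: scaleC_scaleC)
  show "norm (cinner z x *\<^sub>C x) \<le> norm z * (norm x * norm x)"
    using cmod_cinner_le[of z x] by (simp add: norm_scaleC mult_right_mono mult.assoc[symmetric])
qed

lemmas rank1_apply = rank1.rep_eq

lemma cinner_self_unit: "norm u = 1 \<Longrightarrow> cinner u u = 1"
  by (simp add: cinner_self)

lemma rank1_self: "norm u = 1 \<Longrightarrow> rank1 u u = u"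
  by (simp add: rank1_apply cinner_self)

lemma rank1_bounded: "rank1 x \<in> bounded_ops"
  by (simp add: bounded_ops_def rank1_apply cinner_scaleC_left scaleC_scaleC)

lemma rank1_sa [simp, intro]: "rank1 x \<in> self_adjoint_ops"
proof -
  have "inner (rank1 x y) z = inner y (rank1 x z)" for y z
    using cinner_commute[of x z]
    by (simp add: rank1_apply inner_eq_Re_cinner cinner_simps mult.commute)
  then show ?thesis by (simp add: self_adjoint_ops_iff rank1_bounded)
qed

lemma rank1_scaleC: "rank1 (c *\<^sub>C x) = (cmod c)\<^sup>2 *\<^sub>R rank1 x"
proof (rule blinfun_eqI)
  fix z
  have "rank1 (c *\<^sub>C x) z = (c * cnj c * cinner z x) *\<^sub>C x"
    by (simp add: rank1_apply cinner_scaleC_right scaleC_scaleC mult_ac)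
  also have "\<dots> = ((cmod c)\<^sup>2 *\<^sub>R rank1 x) z"
    by (simp only: complex_norm_square[symmetric] scaleC_scaleC[symmetric] scaleC_of_real rank1_apply blinfun.scaleR_left)
  finally show "rank1 (c *\<^sub>C x) z = ((cmod c)\<^sup>2 *\<^sub>R rank1 x) z" .
qed

lemma rank1_scaleR: "rank1 (t *\<^sub>R x) = t\<^sup>2 *\<^sub>R rank1 x"
  using rank1_scaleC[of "of_real t" x] by (simp add: scaleC_of_real)

lemma rank1_idempotent: "norm u = 1 \<Longrightarrow> rank1 u o\<^sub>L rank1 u = rank1 u"
  by (rule blinfun_eqI) (simp add: rank1_apply cinner_scaleC_left cinner_self)

lemma rank1_in_projections:
  assumes "norm u = 1" shows "rank1 u \<in> rank_one_projections"
proof -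
  have "range (rank1 u) = range (\<lambda>c. c *\<^sub>C u)"
  proof (intro equalityI subsetI)
    fix y assume "y \<in> range (\<lambda>c. c *\<^sub>C u)"
    then obtain c where "y = c *\<^sub>C u" by blast
    then have "rank1 u y = y" using assms by (simp add: rank1_apply cinner_scaleC_left cinner_self)
    then show "y \<in> range (rank1 u)" by (metis rangeI)
  qed (auto simp: rank1_apply)
  moreover have "adj (rank1 u) = rank1 u" using rank1_sa[of u] by (simp add: self_adjoint_ops_def)
  moreover have "u \<noteq> 0" using assms by auto
  ultimately show ?thesis
    unfolding rank_one_projections_def using rank1_bounded rank1_idempotent[OF assms] by blast
qed

lemma inner_rank1: "inner (rank1 a b) b = (cmod (cinner b a))\<^sup>2"
proof -
  have "cinner (rank1 a b) b = cinner b a * cnj (cinner b a)"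
    using cinner_commute[of a b] by (simp add: rank1_apply cinner_scaleC_left)
  then show ?thesis by (simp add: inner_eq_Re_cinner flip: complex_norm_square)
qed

lemma norm_diff_projection:
  assumes "norm v = 1"
  shows "(norm (w - cinner w v *\<^sub>C v))\<^sup>2 = (norm w)\<^sup>2 - (cmod (cinner w v))\<^sup>2"
proof -
  have "cinner (w - cinner w v *\<^sub>C v) (cinner w v *\<^sub>C v) = 0"
    using assms by (simp add: cinner_simps cinner_self)
  from norm_add_orthogonal[OF this] show ?thesis
    by (simp add: norm_scaleC assms)
qed

lemma rank1_eqI:
  assumes "norm v = 1" "norm w = 1" "(cmod (cinner w v))\<^sup>2 = 1"
  shows "rank1 w = rank1 v"
proof -
  have "w = cinner w v *\<^sub>C v" using norm_diff_projection[OF assms(1), of w] assms by simp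
  then show ?thesis using rank1_scaleC[of "cinner w v" v] assms(3) by simp
qed

lemma rank1_eq_norm:
  assumes "rank1 v = rank1 w" shows "norm v = norm w"
proof -
  have n: "norm (rank1 x x) = norm x ^ 3" for x :: 'a
    by (simp add: rank1_apply norm_scaleC cinner_self norm_mult power2_eq_square power3_eq_cube)
  have le: "norm x \<le> norm y" if "rank1 x = rank1 y" for x y :: 'a
  proof (cases "x = 0")
    case False
    have "norm x ^ 3 = norm (rank1 y x)" using n[of x] that by simp
    also have "\<dots> \<le> norm x * norm y * norm y"
      using cmod_cinner_le[of x y] by (simp add: rank1_apply norm_scaleC mult_right_mono)
    finally have "(norm x)\<^sup>2 \<le> (norm y)\<^sup>2"
      using False by (simp add: power3_eq_cube power2_eq_square mult.assoc mult_le_cancel_left)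
    then show ?thesis by (rule power2_le_imp_le) simp
  qed simp
  show ?thesis using le[OF assms] le[OF assms[symmetric]] by simp
qed

text \<open>Applying both operators to \<open>v\<close> gives
  \<open>(norm v)^2 *\<^sub>R v = cinner v w *\<^sub>C w\<close>; equality of norms makes the
  quotient a phase.\<close>

lemma rank1_eqD:
  assumes "rank1 v = rank1 w"
  obtains \<omega> where "cmod \<omega> = 1" "v = \<omega> *\<^sub>C w"
proof (cases "v = 0")
  case True
  then show thesis using that[of 1] rank1_eq_norm[OF assms] by simp
next
  case False
  have nw: "norm v = norm w" by (rule rank1_eq_norm[OF assms])
  define k where "k = cinner v w / of_real ((norm v)\<^sup>2)"
  have "rank1 v v = (norm v)\<^sup>2 *\<^sub>R v" by (simp add: rank1_apply cinner_self scaleC_of_real flip: of_real_power)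
  then have "(norm v)\<^sup>2 *\<^sub>R v = cinner v w *\<^sub>C w" by (simp add: assms rank1_apply)
  then have "inverse ((norm v)\<^sup>2) *\<^sub>R ((norm v)\<^sup>2 *\<^sub>R v) = inverse ((norm v)\<^sup>2) *\<^sub>R (cinner v w *\<^sub>C w)" by simp
  then have v: "v = k *\<^sub>C w"
    using False by (simp add: k_def divide_inverse mult.commute flip: scaleC_of_real of_real_power)
      (simp add: scaleC_scaleC mult.commute)
  moreover have "cmod k = 1" using v nw False norm_scaleC[of k w] by (metis mult_cancel_right1 norm_eq_zero)
  ultimately show thesis using that by blast
qed

lemma sa_cinner_real: "A \<in> self_adjoint_ops \<Longrightarrow> cinner (A x) x = of_real (inner (A x) x)"
  using sa_cinner[of A x x] cinner_commute[of "A x" x]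
  by (simp add: complex_eq_iff inner_eq_Re_cinner)

lemma rank1_sandwich:
  assumes "B \<in> self_adjoint_ops"
  shows "rank1 u o\<^sub>L B o\<^sub>L rank1 u = inner (B u) u *\<^sub>R rank1 u"
  by (rule blinfun_eqI)
    (simp add: rank1_apply blinfun.bilinear_simps bounded_opsD[OF sa_bounded[OF assms]] cinner_scaleC_left
      sa_cinner_real[OF assms] mult.commute scaleC_of_real scaleR_scaleC_commute flip: scaleC_scaleC)

text \<open>Not an equation, since 0 is missing in dimension one for nonzero \<open>t\<close>.
  Equality of two such spectra still forces equal coefficients.\<close>

lemma spectrum_scaleR_rank1:
  assumes "norm u = 1"
  shows "spectrum (t *\<^sub>R rank1 u) \<subseteq> {0, of_real t}" "of_real t \<in> spectrum (t *\<^sub>R rank1 u)"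
proof -
  show "spectrum (t *\<^sub>R rank1 u) \<subseteq> {0, of_real t}"
    by (rule quadratic_spectrum)
      (simp_all add: rank1_bounded compose.scaleR_left compose.scaleR_right rank1_idempotent[OF assms])
  show "of_real t \<in> spectrum (t *\<^sub>R rank1 u)"
    by (rule eigenvalue_in_spectrum[of _ u])
      (use assms in \<open>auto simp: blinfun.scaleR_left rank1_self scaleC_of_real\<close>)
qed

lemma spectrum_zero: "spectrum (0 :: 'a::chilbert_space \<Rightarrow>\<^sub>L 'a) \<subseteq> {0}"
  using quadratic_spectrum[of "0 :: 'a \<Rightarrow>\<^sub>L 'a" 0] by simp

lemma spectrum_id: "spectrum (id_blinfun :: 'a::chilbert_space \<Rightarrow>\<^sub>L 'a) \<subseteq> {1}"
proof
  fix l assume l: "l \<in> spectrum (id_blinfun :: 'a \<Rightarrow>\<^sub>L 'a)"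
  have "(id_blinfun :: 'a \<Rightarrow>\<^sub>L 'a) - scalar_op l = scalar_op (1 - l)"
    by (rule blinfun_eqI) (simp add: blinfun.diff_left scalar_op.rep_eq scaleC_diff_left)
  then show "l \<in> {1}" using l invertible_scalar_op[of "1 - l"] by (auto simp: spectrum_iff)
qed

lemma idempotent_fixed_unit:
  fixes P :: "'a::real_normed_vector \<Rightarrow>\<^sub>L 'a"
  assumes "P o\<^sub>L P = P" "P \<noteq> 0"
  obtains u where "norm u = 1" "P u = u"
proof -
  obtain x where x: "P x \<noteq> 0" using assms(2) by (metis blinfun_eqI zero_blinfun.rep_eq)
  have "P (P x) = P x" using assms(1) by (metis blinfun_apply_blinfun_compose)
  then show thesis using x by (intro that[of "P x /\<^sub>R norm (P x)"]) (auto simp: blinfun.scaleR_right)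
qed

section \<open>The action of the map on rank-one projections\<close>

locale sandwich_spectrum =
  fixes r s :: rat and \<phi> :: "('a::chilbert_space \<Rightarrow>\<^sub>L 'a) \<Rightarrow> ('a \<Rightarrow>\<^sub>L 'a)"
  assumes r: "r > 0" and s: "s > 0"
    and surj: "\<phi> ` self_adjoint_ops = self_adjoint_ops"
    and spec: "\<And>A B. A \<in> rank_one_projections \<union> {id_blinfun} \<Longrightarrow> B \<in> self_adjoint_ops \<Longrightarrow>
      spectrum (abs_power A r o\<^sub>L B o\<^sub>L abs_power A s) =
      spectrum (abs_power (\<phi> A) r o\<^sub>L \<phi> B o\<^sub>L abs_power (\<phi> A) s)"
begin

lemma phi_sa: "A \<in> self_adjoint_ops \<Longrightarrow> \<phi> A \<in> self_adjoint_ops"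
  using surj by blast

lemma phi_id: "\<phi> id_blinfun = id_blinfun"
proof (rule abs_power_sandwich_eq_id[OF phi_sa r s])
  have "spectrum (id_blinfun :: 'a \<Rightarrow>\<^sub>L 'a) = spectrum (abs_power (\<phi> id_blinfun) r o\<^sub>L \<phi> id_blinfun o\<^sub>L abs_power (\<phi> id_blinfun) s)"
    using spec[of id_blinfun id_blinfun] by (simp add: abs_power_idempotent r s)
  then show "spectrum (abs_power (\<phi> id_blinfun) r o\<^sub>L \<phi> id_blinfun o\<^sub>L abs_power (\<phi> id_blinfun) s) \<subseteq> {1}"
    by (metis spectrum_id)
qed simp

lemma spectrum_phi: "B \<in> self_adjoint_ops \<Longrightarrow> spectrum (\<phi> B) = spectrum B"
  using spec[of id_blinfun B] by (simp add: phi_id abs_power_idempotent r s)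

lemma phi_rank1_idempotent:
  assumes "norm u = 1"
  shows "\<phi> (rank1 u) o\<^sub>L \<phi> (rank1 u) = \<phi> (rank1 u)" "\<phi> (rank1 u) \<noteq> 0"
proof -
  have sp: "spectrum (\<phi> (rank1 u)) \<subseteq> {0, 1}" "1 \<in> spectrum (\<phi> (rank1 u))"
    using spectrum_scaleR_rank1[OF assms, of 1] by (simp_all add: spectrum_phi)
  show "\<phi> (rank1 u) o\<^sub>L \<phi> (rank1 u) = \<phi> (rank1 u)"
    by (rule sa_idempotentI[OF phi_sa sp(1)]) simp
  show "\<phi> (rank1 u) \<noteq> 0" using sp(2) spectrum_zero by force
qed

lemma spectrum_phi_sandwich:
  assumes u: "norm u = 1" and B: "B \<in> self_adjoint_ops"
  shows "spectrum (\<phi> (rank1 u) o\<^sub>L \<phi> B o\<^sub>L \<phi> (rank1 u)) = spectrum (inner (B u) u *\<^sub>R rank1 u)"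
  using spec[of "rank1 u" B] rank1_in_projections[OF u] B
  by (simp add: abs_power_idempotent r s rank1_idempotent u phi_rank1_idempotent phi_sa rank1_sandwich)

text \<open>If the projection \<open>\<phi> (rank1 u)\<close> had rank at least two, some self-adjoint operator would be
  compressed by it to one with the two nonzero spectral values \<open>1\<close> and \<open>2\<close>.\<close>

lemma phi_rank1:
  assumes u: "norm u = 1"
  obtains w where "norm w = 1" "\<phi> (rank1 u) = rank1 w"
proof -
  define Q where "Q = \<phi> (rank1 u)"
  have Q: "Q \<in> self_adjoint_ops" "Q o\<^sub>L Q = Q" "Q \<noteq> 0"
    using phi_rank1_idempotent[OF u] by (simp_all add: Q_def phi_sa)
  obtain w where w: "norm w = 1" "Q w = w" using idempotent_fixed_unit Q by blast
  have fixed: "y = cinner y w *\<^sub>C w" if y: "Q y = y" for y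
  proof (rule ccontr)
    assume n: "y \<noteq> cinner y w *\<^sub>C w"
    define z where "z = y - cinner y w *\<^sub>C w"
    define v where "v = z /\<^sub>R norm z"
    have z: "z \<noteq> 0" "Q z = z" "cinner z w = 0"
      using n y w by (simp_all add: z_def blinfun.diff_right bounded_opsD[OF sa_bounded[OF Q(1)]] cinner_simps cinner_self)
    have v: "norm v = 1" "Q v = v" "cinner v w = 0"
      using z by (simp_all add: v_def blinfun.scaleR_right cinner_scaleR_left)
    then have v': "cinner w v = 0" by (simp add: cinner_eq_0_commute)
    define B0 where "B0 = rank1 w + 2 *\<^sub>R rank1 v"
    have B0: "B0 \<in> self_adjoint_ops" by (auto simp: B0_def)
    then obtain B where B: "B \<in> self_adjoint_ops" "\<phi> B = B0" using surj by (metis imageE)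
    have Qr: "Q o\<^sub>L rank1 x o\<^sub>L Q = rank1 x" if "Q x = x" for x
      by (rule blinfun_eqI)
        (simp add: rank1_apply bounded_opsD[OF sa_bounded[OF Q(1)]] sa_cinner[OF Q(1)] that)
    \<comment> \<open>\<open>w\<close> and \<open>v\<close> lie in the range of \<open>Q\<close>, so
      compression changes nothing, while the preimage \<open>B\<close> allows the compression only
      one nonzero spectral value.\<close>
    have "Q o\<^sub>L B0 o\<^sub>L Q = B0"
      by (simp add: B0_def compose.add_left compose.add_right compose.scaleR_left compose.scaleR_right Qr w v)
    then have "spectrum B0 \<subseteq> {0, of_real (inner (B u) u)}"
      using spectrum_phi_sandwich[OF u B(1)] spectrum_scaleR_rank1(1)[OF u] by (simp add: B(2) Q_def)
    moreover have "1 \<in> spectrum B0"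
      by (rule eigenvalue_in_spectrum[of _ w])
        (use w v' in \<open>auto simp: B0_def blinfun.bilinear_simps rank1_self rank1_apply cinner_self\<close>)
    moreover have "2 \<in> spectrum B0"
    proof (rule eigenvalue_in_spectrum[of _ v])
      show "B0 v = 2 *\<^sub>C v"
        using v scaleC_of_real[of 2 v]
        by (simp add: B0_def blinfun.bilinear_simps rank1_self) (simp add: rank1_apply)
    qed (use v in auto)
    ultimately have "of_real (inner (B u) u) = (1 :: complex)" "of_real (inner (B u) u) = (2 :: complex)"
      by (metis insertE one_neq_zero zero_neq_numeral singletonD subsetD)+
    then show False by simp
  qed
  have "Q = rank1 w"
  proof (rule blinfun_eqI)
    fix z
    have "Q (Q z) = Q z" using Q(2) by (metis blinfun_apply_blinfun_compose)
    then have "Q z = cinner (Q z) w *\<^sub>C w" by (rule fixed)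
    also have "cinner (Q z) w = cinner z w" by (simp add: sa_cinner[OF Q(1)] w)
    finally show "Q z = rank1 w z" by (simp add: rank1_apply)
  qed
  with w show thesis by (intro that) (simp_all add: Q_def)
qed

lemma phi_expectation:
  assumes u: "norm u = 1" and w: "norm w = 1" "\<phi> (rank1 u) = rank1 w" and B: "B \<in> self_adjoint_ops"
  shows "inner (\<phi> B w) w = inner (B u) u"
proof -
  have "spectrum (inner (\<phi> B w) w *\<^sub>R rank1 w) = spectrum (inner (B u) u *\<^sub>R rank1 u)"
    using spectrum_phi_sandwich[OF u B] by (simp add: w rank1_sandwich phi_sa B)
  then show ?thesis
    using spectrum_scaleR_rank1[OF u, of "inner (B u) u"] spectrum_scaleR_rank1[OF w(1), of "inner (\<phi> B w) w"]
    by (metis insertE singletonD subsetD of_real_eq_iff of_real_eq_0_iff)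
qed

text \<open>A preimage \<open>B\<close> of \<open>rank1 w\<close> is a nonzero projection, not yet
  known to have rank one. A unit vector \<open>u\<close> fixed by \<open>B\<close> has expectation
  1, so the image ray of \<open>u\<close> has overlap 1 with \<open>w\<close> and coincides with its
  ray.\<close>

lemma phi_rank1_surj:
  assumes w: "norm w = 1"
  obtains u where "norm u = 1" "\<phi> (rank1 u) = rank1 w"
proof -
  obtain B where B: "B \<in> self_adjoint_ops" "\<phi> B = rank1 w" using surj rank1_sa by (metis imageE)
  have sp: "spectrum B \<subseteq> {0, 1}" "1 \<in> spectrum B"
    using spectrum_scaleR_rank1[OF w, of 1] spectrum_phi[OF B(1)] by (simp_all add: B(2))
  have "B \<noteq> 0" using sp(2) spectrum_zero by force
  then obtain u where u: "norm u = 1" "B u = u"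
    using idempotent_fixed_unit[OF sa_idempotentI[OF B(1) sp(1)]] by blast
  obtain v where v: "norm v = 1" "\<phi> (rank1 u) = rank1 v" using phi_rank1[OF u(1)] .
  have "inner u u = 1" using u(1) by (simp add: power2_norm_eq_inner[symmetric])
  then have "(cmod (cinner v w))\<^sup>2 = 1"
    using phi_expectation[OF u(1) v B(1)] by (simp add: B(2) u(2) inner_rank1)
  then have "rank1 v = rank1 w" by (rule rank1_eqI[OF w v(1)])
  with u(1) v(2) show thesis by (intro that) auto
qed

end

section \<open>From expectation values to a unitary or antiunitary operator\<close>

text \<open>The polarization of \<open>rank1\<close>, additive in \<open>x\<close>. Written through
  \<open>rank1\<close>, its image under a real-linear map reduces to images of rank-one
  operators.\<close>

definition cross :: "'a::complex_inner \<Rightarrow> 'a \<Rightarrow> 'a \<Rightarrow>\<^sub>L 'a" where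
  "cross x e = rank1 (x + e) - rank1 x - rank1 e"

lemma cross_apply: "cross x e z = cinner z e *\<^sub>C x + cinner z x *\<^sub>C e"
  by (simp add: cross_def blinfun.bilinear_simps rank1_apply cinner_add_right scaleC_add_left
      scaleC_add_right)

lemma cross_sa [simp, intro]: "cross x e \<in> self_adjoint_ops"
  by (auto simp: cross_def)

lemma cross_add: "cross (x + y) e = cross x e + cross y e"
  by (rule blinfun_eqI)
    (simp add: cross_apply blinfun.add_left cinner_add_right scaleC_add_left scaleC_add_right)

lemma cross_scaleR: "cross (t *\<^sub>R x) e = t *\<^sub>R cross x e"
proof (rule blinfun_eqI)
  fix z
  show "cross (t *\<^sub>R x) e z = (t *\<^sub>R cross x e) z"
    by (simp add: cross_apply blinfun.scaleR_left cinner_scaleR_right scaleR_scaleC_commute scaleR_add_right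
        flip: scaleC_scaleC) (simp add: scaleC_of_real)
qed

text \<open>Moving \<open>a\<close> to the other argument of \<open>cross\<close> conjugates it and
  keeps \<open>e\<close> itself as the second argument, the only case in which the image of
  \<open>cross\<close> will be known.\<close>

lemma rank1_decompose: "rank1 (a *\<^sub>C e + u) = (cmod a)\<^sup>2 *\<^sub>R rank1 e + rank1 u + cross (cnj a *\<^sub>C u) e"
proof -
  have "cross (cnj a *\<^sub>C u) e = cross u (a *\<^sub>C e)"
    by (rule blinfun_eqI) (simp add: cross_apply cinner_scaleC_right scaleC_scaleC mult.commute)
  then show ?thesis by (simp add: cross_def rank1_scaleC add.commute)
qed

text \<open>What remains is Wigner's theorem, simplified by the fact that \<open>\<phi>\<close> acts on all self-adjoint operators:
  the expectation values force it to be real linear.\<close>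

locale expectation_map =
  fixes \<phi> :: "('a::chilbert_space \<Rightarrow>\<^sub>L 'a) \<Rightarrow> ('a \<Rightarrow>\<^sub>L 'a)"
  assumes sa: "A \<in> self_adjoint_ops \<Longrightarrow> \<phi> A \<in> self_adjoint_ops"
    and ray: "norm u = 1 \<Longrightarrow> \<exists>w. norm w = 1 \<and> \<phi> (rank1 u) = rank1 w"
    and ray_surj: "norm w = 1 \<Longrightarrow> \<exists>u. norm u = 1 \<and> \<phi> (rank1 u) = rank1 w"
    and expectation: "norm u = 1 \<Longrightarrow> norm w = 1 \<Longrightarrow> \<phi> (rank1 u) = rank1 w \<Longrightarrow>
      B \<in> self_adjoint_ops \<Longrightarrow> inner (\<phi> B w) w = inner (B u) u"
begin

text \<open>Expectation values determine a self-adjoint operator, and by \<open>ray_surj\<close>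
  every unit vector represents the image of some ray.\<close>

lemma phi_eqI:
  assumes "A \<in> self_adjoint_ops" "B \<in> self_adjoint_ops"
    and "\<And>u w. norm u = 1 \<Longrightarrow> norm w = 1 \<Longrightarrow> \<phi> (rank1 u) = rank1 w \<Longrightarrow> inner (A w) w = inner (B w) w"
  shows "A = B"
  by (rule sa_eqI[OF assms(1,2)]) (use ray_surj assms(3) in blast)

lemma phi_add: "A \<in> self_adjoint_ops \<Longrightarrow> B \<in> self_adjoint_ops \<Longrightarrow> \<phi> (A + B) = \<phi> A + \<phi> B"
  by (rule phi_eqI) (auto simp: sa expectation blinfun.add_left inner_add_left)

lemma phi_scaleR: "A \<in> self_adjoint_ops \<Longrightarrow> \<phi> (t *\<^sub>R A) = t *\<^sub>R \<phi> A"
  by (rule phi_eqI) (auto simp: sa expectation blinfun.scaleR_left)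

lemma phi_diff: "A \<in> self_adjoint_ops \<Longrightarrow> B \<in> self_adjoint_ops \<Longrightarrow> \<phi> (A - B) = \<phi> A - \<phi> B"
  by (rule phi_eqI) (auto simp: sa expectation blinfun.diff_left inner_diff_left)

lemma phi_zero: "\<phi> 0 = 0"
  using phi_scaleR[of 0 0] by simp

lemma transition_probability:
  assumes "norm x = 1" "norm y = 1" "\<phi> (rank1 x) = rank1 y"
    and "\<phi> (rank1 a) = rank1 b"
  shows "(cmod (cinner y b))\<^sup>2 = (cmod (cinner x a))\<^sup>2"
  using expectation[OF assms(1-3), of "rank1 a"] assms(4) by (simp add: inner_rank1)

text \<open>The vector \<open>(x + e) / sqrt 2\<close> is sent to the ray of some \<open>h\<close> in the span of \<open>f\<close> and the
  image \<open>g\<close> of \<open>x\<close>; the phase of \<open>y\<close> is chosen so that \<open>h\<close> is a multiple of \<open>y + f\<close>.\<close>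

lemma orthogonal_unit:
  assumes e: "norm e = 1" "norm f = 1" "\<phi> (rank1 e) = rank1 f"
    and x: "norm x = 1" "cinner x e = 0"
  shows "\<exists>y. norm y = 1 \<and> cinner y f = 0 \<and> \<phi> (rank1 x) = rank1 y \<and> \<phi> (cross x e) = cross y f"
proof -
  define u where "u = (1 / sqrt 2) *\<^sub>R (x + e)"
  have ex: "cinner e x = 0" using x by (simp add: cinner_eq_0_commute)
  have "(norm (x + e))\<^sup>2 = 2" using norm_add_orthogonal[OF x(2)] x e by simp
  then have "norm (x + e) = sqrt 2" by (simp add: real_sqrt_unique)
  then have u: "norm u = 1" by (simp add: u_def)
  have half: "(cmod (complex_of_real (1 / sqrt 2)))\<^sup>2 = 1 / 2"
    by (simp add: norm_divide power_divide)
  have ue: "cinner u e = of_real (1 / sqrt 2)" "cinner u x = of_real (1 / sqrt 2)"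
    using e x ex by (simp_all only: u_def cinner_scaleR_left cinner_add_left cinner_self_unit) simp_all
  obtain g where g: "norm g = 1" "\<phi> (rank1 x) = rank1 g" using ray[OF x(1)] by blast
  obtain h where h: "norm h = 1" "\<phi> (rank1 u) = rank1 h" using ray[OF u] by blast
  define \<alpha> \<beta> where "\<alpha> = cinner h f" and "\<beta> = cinner h g"
  \<comment> \<open>Transition probabilities are preserved, and those of \<open>u\<close> with
    \<open>e\<close> and with \<open>x\<close> are both 1/2.\<close>
  have \<alpha>: "(cmod \<alpha>)\<^sup>2 = 1 / 2" and \<beta>: "(cmod \<beta>)\<^sup>2 = 1 / 2"
    unfolding \<alpha>_def \<beta>_def
    using transition_probability[OF u h e(3)] transition_probability[OF u h g(2)] half ue by simp_all
  have gf: "cinner g f = 0" using transition_probability[OF x(1) g e(3)] x(2) by simp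
  have fg: "cinner f g = 0" using gf by (simp add: cinner_eq_0_commute)
  \<comment> \<open>Removing the components along \<open>f\<close> and \<open>g\<close> uses up the
    squared norm, 1 - 1/2 - 1/2 = 0, so \<open>h\<close> lies in their span.\<close>
  define k where "k = h - \<alpha> *\<^sub>C f"
  have "(norm k)\<^sup>2 = 1 / 2" using norm_diff_projection[OF e(2), of h] h(1) \<alpha> by (simp add: k_def \<alpha>_def)
  moreover have "cinner k g = \<beta>" by (simp add: k_def cinner_simps fg \<beta>_def)
  ultimately have "(norm (k - \<beta> *\<^sub>C g))\<^sup>2 = 0"
    using norm_diff_projection[OF g(1), of k] \<beta> by simp
  then have hh: "h = \<alpha> *\<^sub>C f + \<beta> *\<^sub>C g" by (simp add: k_def algebra_simps)
  \<comment> \<open>The factor has modulus 2 * (1/2) = 1, so \<open>y\<close> spans the ray of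
    \<open>g\<close>; times \<open>\<alpha>\<close> it is \<open>\<beta>\<close>, because
    \<open>\<alpha> * cnj \<alpha>\<close> is 1/2.\<close>
  define y where "y = (2 * cnj \<alpha> * \<beta>) *\<^sub>C g"
  have c1: "(cmod (2 * cnj \<alpha> * \<beta>))\<^sup>2 = 1" by (simp add: norm_mult power_mult_distrib \<alpha> \<beta>)
  then have "cmod (2 * cnj \<alpha> * \<beta>) = 1" by (metis norm_ge_zero one_power2 power2_eq_imp_eq zero_le_one)
  then have y: "norm y = 1" "cinner y f = 0" "rank1 y = rank1 g"
    using c1 g gf rank1_scaleC[of "2 * cnj \<alpha> * \<beta>" g] by (simp_all add: y_def norm_scaleC cinner_scaleC_left)
  have "\<alpha> * cnj \<alpha> = 1 / 2" by (simp add: \<alpha> flip: complex_norm_square of_real_power)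
  then have phase: "\<alpha> * (2 * cnj \<alpha> * \<beta>) = \<beta>" by (metis (no_types, lifting) mult.assoc mult.commute mult.left_neutral nonzero_eq_divide_eq zero_neq_numeral)
  have "h = \<alpha> *\<^sub>C (y + f)" by (simp add: hh y_def scaleC_add_right scaleC_scaleC add.commute phase)
  then have "rank1 h = (1 / 2) *\<^sub>R rank1 (y + f)" by (simp add: rank1_scaleC \<alpha>)
  moreover have "rank1 u = (1 / 2) *\<^sub>R rank1 (x + e)" by (simp add: u_def rank1_scaleR power_divide)
  ultimately have "\<phi> (rank1 (x + e)) = rank1 (y + f)"
    using h(2) by (simp add: phi_scaleR)
  then have "\<phi> (cross x e) = cross y f"
    using e(3) g(2) y(3) by (simp add: cross_def phi_diff)
  with y g show ?thesis by auto
qed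

text \<open>Scaling from the unit case: \<open>rank1\<close> is quadratic and \<open>cross\<close>
  linear in real multiples of \<open>x\<close>, so one multiple of \<open>y\<close> serves
  both.\<close>

lemma orthogonal_vector:
  assumes e: "norm e = 1" "norm f = 1" "\<phi> (rank1 e) = rank1 f" and x: "cinner x e = 0"
  shows "\<exists>y. norm y = norm x \<and> cinner y f = 0 \<and> \<phi> (rank1 x) = rank1 y \<and> \<phi> (cross x e) = cross y f"
proof (cases "x = 0")
  case True
  have "rank1 (0::'a) = 0" "cross (0::'a) z = 0" for z
    using rank1_scaleR[of 0 "0::'a"] cross_scaleR[of 0 "0::'a" z] by simp_all
  with True show ?thesis by (intro exI[of _ 0]) (simp add: phi_zero)
next
  case False
  define x' where "x' = x /\<^sub>R norm x"
  have "norm x' = 1" "cinner x' e = 0" using False x by (simp_all add: x'_def cinner_scaleR_left)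
  then obtain y where y: "norm y = 1" "cinner y f = 0" "\<phi> (rank1 x') = rank1 y" "\<phi> (cross x' e) = cross y f"
    using orthogonal_unit[OF e] by blast
  have x: "x = norm x *\<^sub>R x'" using False by (simp add: x'_def)
  have "\<phi> (rank1 x) = rank1 (norm x *\<^sub>R y)"
    by (subst x) (simp add: rank1_scaleR phi_scaleR y)
  moreover have "\<phi> (cross x e) = cross (norm x *\<^sub>R y) f"
    by (subst x) (simp add: cross_scaleR phi_scaleR y)
  ultimately show ?thesis using y by (intro exI[of _ "norm x *\<^sub>R y"]) (simp add: cinner_scaleR_left)
qed

text \<open>Knowing \<open>T\<close> on rays suffices, because expectation values carry the formula
  over to every self-adjoint operator. In both alternatives \<open>\<kappa>\<close> fixes the reals
  and is its own inverse.\<close>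

lemma phi_unitary:
  assumes T: "\<And>x y. T (x + y) = T x + T y" "\<And>c x. T (c *\<^sub>C x) = \<kappa> c *\<^sub>C T x" "\<And>x. norm (T x) = norm x"
    and \<kappa>: "\<kappa> = id \<or> \<kappa> = cnj"
    and rank1: "\<And>x. \<phi> (rank1 x) = rank1 (T x)"
  shows "\<exists>T :: 'a \<Rightarrow>\<^sub>L 'a. (T \<in> bounded_ops \<or> T \<in> conj_linear_ops) \<and> bij (blinfun_apply T) \<and>
    blinfun_apply (adj T) = inv (blinfun_apply T) \<and> (\<forall>A \<in> self_adjoint_ops. \<phi> A = T o\<^sub>L A o\<^sub>L adj T)"
proof -
  have \<kappa>_real: "\<kappa> (of_real t) = of_real t" and \<kappa>_inv: "\<kappa> (\<kappa> c) = c" for t c using \<kappa> by auto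
  have bl: "bounded_linear T"
  proof (rule bounded_linear_intro)
    show "T (t *\<^sub>R x) = t *\<^sub>R T x" for t x
      using T(2)[of "of_real t" x] by (simp add: \<kappa>_real scaleC_of_real)
    show "norm (T x) \<le> norm x * 1" for x by (simp add: T(3))
  qed (rule T(1))
  define U where "U = Blinfun T"
  have U: "blinfun_apply U = T" unfolding U_def by (rule bounded_linear_Blinfun_apply[OF bl])
  have lin: "U \<in> bounded_ops \<or> U \<in> conj_linear_ops"
    using \<kappa> T(2) by (auto simp: bounded_ops_def conj_linear_ops_def U)
  interpret T: bounded_linear T by (rule bl)
  have T_inner: "inner (T x) (T y) = inner x y" for x y
    by (simp add: dot_norm T.add[symmetric] T(3))
  have inj: "x = y" if "T x = T y" for x y
    using T(3)[of "x - y"] that by (simp add: T.diff)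
  \<comment> \<open>The ray of \<open>y\<close> is that of some \<open>T u\<close>; the remaining
    phase \<open>\<omega>\<close> moves into the argument as
    \<open>\<kappa> \<omega>\<close>.\<close>
  have surj_T: "\<exists>x. T x = y" for y
  proof (cases "y = 0")
    case False
    then have "norm (y /\<^sub>R norm y) = 1" by simp
    then obtain u where u: "norm u = 1" "rank1 (T u) = rank1 (y /\<^sub>R norm y)"
      using ray_surj rank1 by metis
    obtain \<omega> where "y /\<^sub>R norm y = \<omega> *\<^sub>C T u" using rank1_eqD[OF u(2)[symmetric]] by blast
    also have "\<dots> = T (\<kappa> \<omega> *\<^sub>C u)" by (simp add: T(2) \<kappa>_inv)
    finally have "T (norm y *\<^sub>R (\<kappa> \<omega> *\<^sub>C u)) = norm y *\<^sub>R (y /\<^sub>R norm y)" by (simp add: T.scaleR)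
    then show ?thesis using False by (intro exI) simp
  qed (auto intro: exI[of _ 0] simp: T.zero)
  have bij: "bij T" using inj surj_T by (metis bijI injI surjI)
  have adj: "adj U (T y) = y" for y
  proof -
    have "inner x (adj U (T y)) = inner x y" for x
      using adj_inner[OF lin, of x "T y"] by (simp add: U T_inner)
    then show ?thesis by (metis vector_eq_ldot)
  qed
  have adj_inv: "blinfun_apply (adj U) = inv T"
    by (rule ext) (metis adj surj_T bij bij_inv_eq_iff)
  have T_adj: "T (adj U y) = y" for y by (metis adj surj_T)
  have "\<phi> A = U o\<^sub>L A o\<^sub>L adj U" if A: "A \<in> self_adjoint_ops" for A
  proof (rule sa_eqI[OF sa[OF A]])
    \<comment> \<open>The adjoint is homogeneous in the same sense as \<open>T\<close>, so
      conjugations cancel and the product is complex linear.\<close>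
    have adj_scale: "adj U (c *\<^sub>C x) = \<kappa> c *\<^sub>C adj U x" for c x
      by (rule inj) (simp add: T(2) T_adj \<kappa>_inv)
    have "(U o\<^sub>L A o\<^sub>L adj U) \<in> bounded_ops"
      by (simp add: bounded_ops_def adj_scale U T(2) bounded_opsD[OF sa_bounded[OF A]] \<kappa>_inv)
    moreover have "inner ((U o\<^sub>L A o\<^sub>L adj U) x) y = inner x ((U o\<^sub>L A o\<^sub>L adj U) y)" for x y
      using sa_inner[OF A, of "adj U x" "adj U y"] T_inner[of "A (adj U x)" "adj U y"] T_inner[of "adj U x" "A (adj U y)"]
      by (simp add: U T_adj)
    ultimately show "U o\<^sub>L A o\<^sub>L adj U \<in> self_adjoint_ops" by (simp add: self_adjoint_ops_iff)
    fix w :: 'a assume w: "norm w = 1"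
    define u where "u = adj U w"
    have u: "w = T u" by (simp add: u_def T_adj)
    then have "norm u = 1" using w by (simp add: T(3))
    then have "inner (\<phi> A w) w = inner (A u) u"
      using expectation[of u w A] w rank1[of u] A u by simp
    also have "\<dots> = inner ((U o\<^sub>L A o\<^sub>L adj U) w) w"
      by (simp add: u U adj T_inner)
    finally show "inner (\<phi> A w) w = inner ((U o\<^sub>L A o\<^sub>L adj U) w) w" .
  qed
  then show ?thesis using lin bij adj_inv U by (intro exI[of _ U]) simp
qed

lemma wigner:
  "\<exists>T :: 'a \<Rightarrow>\<^sub>L 'a. (T \<in> bounded_ops \<or> T \<in> conj_linear_ops) \<and> bij (blinfun_apply T) \<and>
    blinfun_apply (adj T) = inv (blinfun_apply T) \<and> (\<forall>A \<in> self_adjoint_ops. \<phi> A = T o\<^sub>L A o\<^sub>L adj T)"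
proof (cases "\<exists>e :: 'a. e \<noteq> 0")
  case False
  \<comment> \<open>The zero space offers no unit vector \<open>e\<close>, but it has only one
    operator.\<close>
  then have "A = B" for A B :: "'a \<Rightarrow>\<^sub>L 'a" by (intro blinfun_eqI) metis
  then have "\<phi> (rank1 x) = rank1 x" for x by blast
  then show ?thesis by (intro phi_unitary[of "\<lambda>x. x" id]) auto
next
  case True
  then obtain e0 :: 'a where "e0 \<noteq> 0" by blast
  define e where "e = e0 /\<^sub>R norm e0"
  have e: "norm e = 1" using \<open>e0 \<noteq> 0\<close> by (simp add: e_def)
  obtain f where f: "norm f = 1" "\<phi> (rank1 e) = rank1 f" using ray[OF e] by blast
  \<comment> \<open>For \<open>y\<close> orthogonal to \<open>f\<close>, evaluating
    \<open>cross y f\<close> at \<open>f\<close> returns \<open>y\<close>. The explicit formula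
    makes \<open>S\<close> real linear on the whole space, with no phases to choose.\<close>
  define S where "S x = \<phi> (cross x e) f" for x
  have S: "norm (S x) = norm x" "cinner (S x) f = 0" "\<phi> (rank1 x) = rank1 (S x)" "\<phi> (cross x e) = cross (S x) f"
    if x: "cinner x e = 0" for x
  proof -
    obtain y where y: "norm y = norm x" "cinner y f = 0" "\<phi> (rank1 x) = rank1 y" "\<phi> (cross x e) = cross y f"
      using orthogonal_vector[OF e f x] by blast
    have "cinner f y = 0" using y(2) by (simp add: cinner_eq_0_commute)
    then have "S x = y" by (simp add: S_def y(4) cross_apply cinner_self f)
    with y show "norm (S x) = norm x" "cinner (S x) f = 0" "\<phi> (rank1 x) = rank1 (S x)" "\<phi> (cross x e) = cross (S x) f"
      by simp_all
  qed
  have S_add: "S (x + y) = S x + S y" for x y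
    by (simp add: S_def cross_add phi_add blinfun.add_left)
  have S_scaleR: "S (t *\<^sub>R x) = t *\<^sub>R S x" for t x
    by (simp add: S_def cross_scaleR phi_scaleR blinfun.scaleR_left)
  have S_i: "S (\<i> *\<^sub>C x) = \<i> *\<^sub>C S x \<or> S (\<i> *\<^sub>C x) = (- \<i>) *\<^sub>C S x" if x: "cinner x e = 0" for x
  proof (cases "x = 0")
    case False
    have ix: "cinner (\<i> *\<^sub>C x) e = 0" using x by (simp add: cinner_scaleC_left)
    have "rank1 (S (\<i> *\<^sub>C x)) = rank1 (S x)"
      using S(3)[OF ix] S(3)[OF x] by (simp add: rank1_scaleC)
    then obtain \<omega> where \<omega>: "cmod \<omega> = 1" "S (\<i> *\<^sub>C x) = \<omega> *\<^sub>C S x" by (rule rank1_eqD)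
    \<comment> \<open>Comparing norms at x + i x gives |1 + \<open>\<omega>\<close>| = |1 + i|; with
      |\<open>\<omega>\<close>| = 1 the real part of \<open>\<omega>\<close> vanishes.\<close>
    have "cinner (x + \<i> *\<^sub>C x) e = 0" using x by (simp add: cinner_simps)
    then have "norm (S (x + \<i> *\<^sub>C x)) = norm (x + \<i> *\<^sub>C x)" by (rule S)
    moreover have "S (x + \<i> *\<^sub>C x) = (1 + \<omega>) *\<^sub>C S x" by (simp add: S_add \<omega> scaleC_add_left)
    moreover have "x + \<i> *\<^sub>C x = (1 + \<i>) *\<^sub>C x" by (simp add: scaleC_add_left)
    ultimately have "cmod (1 + \<omega>) = cmod (1 + \<i>)" using False by (simp add: norm_scaleC S(1)[OF x])
    then have "(cmod (1 + \<omega>))\<^sup>2 = (cmod (1 + \<i>))\<^sup>2" by simp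
    moreover have "(cmod \<omega>)\<^sup>2 = 1" using \<omega> by simp
    ultimately have "(1 + Re \<omega>)\<^sup>2 + (Im \<omega>)\<^sup>2 = 2" "(Re \<omega>)\<^sup>2 + (Im \<omega>)\<^sup>2 = 1"
      by (simp_all add: cmod_power2)
    then have "Re \<omega> = 0" by (simp add: power2_sum)
    with \<open>(Re \<omega>)\<^sup>2 + (Im \<omega>)\<^sup>2 = 1\<close> have "(Im \<omega>)\<^sup>2 = 1" by simp
    with \<open>Re \<omega> = 0\<close> have "\<omega> = \<i> \<or> \<omega> = - \<i>" by (auto simp: complex_eq_iff power2_eq_1_iff)
    then show ?thesis using \<omega> by auto
  qed (use S(1)[of 0] in simp)
  have "(\<forall>x. cinner x e = 0 \<longrightarrow> S (\<i> *\<^sub>C x) = \<i> *\<^sub>C S x) \<or> (\<forall>x. cinner x e = 0 \<longrightarrow> S (\<i> *\<^sub>C x) = (- \<i>) *\<^sub>C S x)"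
  proof (rule ccontr)
    assume "\<not> ?thesis"
    then obtain x y where x: "cinner x e = 0" "S (\<i> *\<^sub>C x) \<noteq> \<i> *\<^sub>C S x"
      and y: "cinner y e = 0" "S (\<i> *\<^sub>C y) \<noteq> (- \<i>) *\<^sub>C S y" by blast
    have x': "S (\<i> *\<^sub>C x) = - (\<i> *\<^sub>C S x)" and y': "S (\<i> *\<^sub>C y) = \<i> *\<^sub>C S y"
      using S_i[OF x(1)] S_i[OF y(1)] x(2) y(2) by auto
    have "S (\<i> *\<^sub>C (x + y)) = - (\<i> *\<^sub>C S x) + \<i> *\<^sub>C S y"
      by (simp add: scaleC_add_right S_add x' y')
    moreover have "S (\<i> *\<^sub>C (x + y)) = \<i> *\<^sub>C S (x + y) \<or> S (\<i> *\<^sub>C (x + y)) = (- \<i>) *\<^sub>C S (x + y)"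
      using x y by (intro S_i) (simp add: cinner_add_left)
    \<comment> \<open>The sign for \<open>x + y\<close> conflicts with that of \<open>x\<close> or
      of \<open>y\<close>; the vector concerned equals its own negative and then satisfies both
      alternatives.\<close>
    ultimately have "\<i> *\<^sub>C S x = - (\<i> *\<^sub>C S x) \<or> \<i> *\<^sub>C S y = - (\<i> *\<^sub>C S y)"
      by (auto simp: S_add scaleC_add_right)
    then show False using x(2) y(2) x' y' by auto
  qed
  then obtain \<kappa> where \<kappa>: "\<kappa> = id \<or> \<kappa> = cnj" and \<kappa>_i: "\<And>x. cinner x e = 0 \<Longrightarrow> S (\<i> *\<^sub>C x) = \<kappa> \<i> *\<^sub>C S x"
    by (metis complex_cnj_i id_apply)
  have S_scaleC: "S (c *\<^sub>C x) = \<kappa> c *\<^sub>C S x" if "cinner x e = 0" for c x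
  proof -
    have "S (c *\<^sub>C x) = Re c *\<^sub>R S x + Im c *\<^sub>R (\<kappa> \<i> *\<^sub>C S x)"
      by (subst scaleC_eq_Re_Im) (simp add: S_add S_scaleR \<kappa>_i[OF that])
    also have "\<dots> = \<kappa> c *\<^sub>C S x"
      using \<kappa> scaleC_eq_Re_Im[of "\<kappa> c" "S x"] by auto
    finally show ?thesis .
  qed
  have \<kappa>_add: "\<kappa> (a + b) = \<kappa> a + \<kappa> b" and \<kappa>_mult: "\<kappa> (a * b) = \<kappa> a * \<kappa> b"
    and \<kappa>_cnj: "\<kappa> (cnj a) = cnj (\<kappa> a)" and \<kappa>_norm: "cmod (\<kappa> a) = cmod a" for a b
    using \<kappa> by auto
  define p where "p x = x - cinner x e *\<^sub>C e" for x
  have p: "cinner (p x) e = 0" "p (x + y) = p x + p y" "p (c *\<^sub>C x) = c *\<^sub>C p x" for x y c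
    using e by (simp_all add: p_def cinner_simps cinner_self scaleC_add_left scaleC_diff_right scaleC_scaleC algebra_simps)
  have x_eq: "x = cinner x e *\<^sub>C e + p x" for x by (simp add: p_def)
  \<comment> \<open>Applying \<open>\<kappa>\<close> to the coefficient of \<open>e\<close> matches
    the homogeneity of \<open>S\<close> on the complement.\<close>
  define T where "T x = \<kappa> (cinner x e) *\<^sub>C f + S (p x)" for x
  show ?thesis
  proof (rule phi_unitary[OF _ _ _ \<kappa>])
    show "T (x + y) = T x + T y" for x y
      by (simp add: T_def cinner_add_left \<kappa>_add p(2) S_add scaleC_add_left)
    show "T (c *\<^sub>C x) = \<kappa> c *\<^sub>C T x" for c x
      by (simp add: T_def cinner_scaleC_left \<kappa>_mult p(3) S_scaleC[OF p(1)] scaleC_add_right scaleC_scaleC)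
    show "norm (T x) = norm x" for x
    proof -
      have "cinner (\<kappa> (cinner x e) *\<^sub>C f) (S (p x)) = 0" "cinner (cinner x e *\<^sub>C e) (p x) = 0"
        using S(2)[OF p(1)] p(1) by (simp_all add: cinner_scaleC_left cinner_eq_0_commute)
      from this[THEN norm_add_orthogonal] have "(norm (T x))\<^sup>2 = (norm (cinner x e *\<^sub>C e + p x))\<^sup>2"
        by (simp only: T_def norm_scaleC \<kappa>_norm S(1)[OF p(1)] e f)
      then have "(norm (T x))\<^sup>2 = (norm x)\<^sup>2" by (simp only: x_eq[symmetric])
      then show ?thesis by simp
    qed
    show "\<phi> (rank1 x) = rank1 (T x)" for x
    proof -
      define a where "a = cinner x e"
      have "\<phi> (rank1 x) = \<phi> (rank1 (a *\<^sub>C e + p x))" using x_eq[of x] by (simp add: a_def)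
      also have "\<dots> = (cmod a)\<^sup>2 *\<^sub>R rank1 f + rank1 (S (p x)) + cross (S (cnj a *\<^sub>C p x)) f"
        using S(3)[OF p(1)[of x]] S(4)[of "cnj a *\<^sub>C p x"] p(1)[of x]
        by (simp add: rank1_decompose phi_add phi_scaleR f cinner_scaleC_left)
      \<comment> \<open>The scalar \<open>cnj a\<close> leaves \<open>S\<close> as
        \<open>\<kappa> (cnj a) = cnj (\<kappa> a)\<close>, which is the coefficient that
        \<open>rank1_decompose\<close> requires for \<open>\<kappa> a\<close>.\<close>
      also have "\<dots> = rank1 (\<kappa> a *\<^sub>C f + S (p x))"
        by (simp add: rank1_decompose S_scaleC[OF p(1)] \<kappa>_cnj \<kappa>_norm)
      finally show ?thesis by (simp add: T_def a_def)
    qed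
  qed
qed

end

theorem theorem1p1:
  fixes r s :: rat
    and \<phi> :: "('a::chilbert_space \<Rightarrow>\<^sub>L 'a) \<Rightarrow> ('a \<Rightarrow>\<^sub>L 'a)"
  assumes "r > 0" and "s > 0" and "r + s > 1"
    and surj: "\<phi> ` self_adjoint_ops = self_adjoint_ops"
    and spec: "\<And>A B. A \<in> rank_one_projections \<union> {id_blinfun} \<Longrightarrow> B \<in> self_adjoint_ops \<Longrightarrow>
      spectrum (abs_power A r o\<^sub>L B o\<^sub>L abs_power A s) =
      spectrum (abs_power (\<phi> A) r o\<^sub>L \<phi> B o\<^sub>L abs_power (\<phi> A) s)"
  shows "\<exists>T :: 'a \<Rightarrow>\<^sub>L 'a.
    (T \<in> bounded_ops \<or> T \<in> conj_linear_ops) \<and>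
    bij (blinfun_apply T) \<and>
    blinfun_apply (adj T) = inv (blinfun_apply T) \<and>
    (\<forall>A \<in> self_adjoint_ops. \<phi> A = T o\<^sub>L A o\<^sub>L adj T)"
proof -
  interpret sandwich_spectrum r s \<phi>
    by unfold_locales (use assms in simp_all)
  interpret expectation_map \<phi>
    by unfold_locales (blast intro: phi_sa phi_expectation elim: phi_rank1 phi_rank1_surj)+
  show ?thesis by (rule wigner)
qed

end
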